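(* Let $G$ be a finite group, $k$ a field, $\alpha\in Z^2(G,k^\times)$ a $2$-cocycle, $k_\alpha G$ the twisted group algebra and $M$ a $(k_\alpha G,k_\alpha G)$-bimodule. For $n\ge 1$, $\varphi\in C^n(k_\alpha G,M)$ and $1\le i\le n$ define $\sigma_i\varphi\in C^n(k_\alpha G,M)$ by $k$-linear extension of the following formulas on basis elements: for $n\ge2$, $$(\sigma_1\varphi)(\overline{g_1}\otimes\dots\otimes\overline{g_n})=-\overline{g_1}\cdot\varphi(\overline{g_1}^{-1}\otimes\overline{g_1}\cdot\overline{g_2}\otimes\dots\otimes\overline{g_n}),$$ $$(\sigma_i\varphi)(\overline{g_1}\otimes\dots\otimes\overline{g_n})=-\varphi(\overline{g_1}\otimes\dots\otimes\overline{g_{i-2}}\otimes\overline{g_{i-1}}\cdot\overline{g_i}\otimes\overline{g_i}^{-1}\otimes\overline{g_i}\cdot\overline{g_{i+1}}\otimes\overline{g_{i+2}}\otimes\dots\otimes\overline{g_n})\quad(1<i<n),$$ $$(\sigma_n\varphi)(\overline{g_1}\otimes\dots\otimes\overline{g_n})=-\varphi(\overline{g_1}\otimes\overline{g_2}\otimes\dots\otimes\overline{g_{n-1}}\cdot\overline{g_n}\otimes\overline{g_n}^{-1})\cdot\overline{g_n},$$ and for $n=1$, $(\sigma_1\varphi)(\overline{g_1})=-\overline{g_1}\cdot\varphi(\overline{g_1}^{-1})\cdot\overline{g_1}$. These relations determine an action of the symmetric group $\Sigma_{n+1}$ on $C^n(k_\alpha G,M)$, with the transposition $(i,i+1)$ acting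 as $\sigma_i$. This action is compatible with the differential $\delta^*$, that is, $\delta^n(\varphi)\in C^{n+1}(k_\alpha G,M)^{\Sigma_{n+2}}$ whenever $\varphi\in C^n(k_\alpha G,M)^{\Sigma_{n+1}}$, for every $n\ge0$ (where $\Sigma_1$ acts trivially on $C^0$).
   Context: $\alpha:G\times G\to k^\times$ satisfies $\alpha(x,yz)\alpha(y,z)=\alpha(xy,z)\alpha(x,y)$ and $\alpha(x,1)=\alpha(1,x)=1$. $k_\alpha G$ is the $k$-algebra with $k$-basis $\{\bar g\mid g\in G\}$ and multiplication $\bar g\cdot\bar h=\alpha(g,h)\overline{gh}$; thus $\bar g^{-1}=\alpha(g,g^{-1})^{-1}\overline{g^{-1}}$. The dot also denotes left and right actions on $M$. The Hochschild cochain complex is $C^n(k_\alpha G,M)=\mathrm{Hom}_k((k_\alpha G)^{\otimes n},M)$ for $n>0$, $C^0(k_\alpha G,M)=M$, with $\delta^n(\varphi)(a_1\otimes\dots\otimes a_{n+1})=a_1\cdot\varphi(a_2\otimes\dots\otimes a_{n+1})+\sum_{j=1}^n(-1)^j\varphi(a_1\otimes\dots\otimes a_j\cdot a_{j+1}\otimes\dots\otimes a_{n+1})+(-1)^{n+1}\varphi(a_1\otimes\dots\otimes a_n)\cdot a_{n+1}$ and $\delta^0(m)(a)=a\cdot m-m\cdot a$. *)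

theory Defs
  imports Complex_Main "HOL-Algebra.Sym_Groups" "HOL-Algebra.Group_Action" "HOL-Algebra.Module"
begin

section \<open>Twisted group algebras\<close>

definition normalized_2cocycle :: "('g, 'z) monoid_scheme \<Rightarrow> ('g \<Rightarrow> 'g \<Rightarrow> 'k::field) \<Rightarrow> bool" where
  "normalized_2cocycle G \<alpha> \<longleftrightarrow>
     (\<forall>x\<in>carrier G. \<forall>y\<in>carrier G. \<alpha> x y \<noteq> 0) \<and>
     (\<forall>x\<in>carrier G. \<forall>y\<in>carrier G. \<forall>z\<in>carrier G.
        \<alpha> x (y \<otimes>\<^bsub>G\<^esub> z) * \<alpha> y z = \<alpha> (x \<otimes>\<^bsub>G\<^esub> y) z * \<alpha> x y) \<and>
     (\<forall>x\<in>carrier G. \<alpha> x \<one>\<^bsub>G\<^esub> = 1 \<and> \<alpha> \<one>\<^bsub>G\<^esub> x = 1)"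

definition basis_elem :: "'g \<Rightarrow> 'g \<Rightarrow> 'k::field" where
  "basis_elem g = (\<lambda>x. if x = g then 1 else 0)"

text \<open>
  An element \<open>\<Sum>\<^sub>g c\<^sub>g \<cdot> g\<close> of the algebra is represented by its coefficient function \<open>g \<mapsto> c\<^sub>g\<close>, which
  vanishes outside of the group; the group is meant to be finite. The product is the bilinear
  extension of the product of basis elements, cf. \<open>mult_basis_elem\<close> below.
\<close>

definition twisted_group_algebra ::
  "('g, 'z) monoid_scheme \<Rightarrow> ('g \<Rightarrow> 'g \<Rightarrow> 'k) \<Rightarrow> ('k::field, 'g \<Rightarrow> 'k) module" where
  "twisted_group_algebra G \<alpha> =
     \<lparr>carrier = {a. \<forall>x. x \<notin> carrier G \<longrightarrow> a x = 0},
      mult = (\<lambda>a b x. \<Sum>g\<in>carrier G. \<Sum>h\<in>carrier G.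
                 if g \<otimes>\<^bsub>G\<^esub> h = x then a g * b h * \<alpha> g h else 0),
      one = basis_elem \<one>\<^bsub>G\<^esub>,
      zero = (\<lambda>x. 0),
      add = (\<lambda>a b x. a x + b x),
      smult = (\<lambda>c a x. c * a x)\<rparr>"

locale twisted_group = group G for G (structure) +
  fixes \<alpha> :: "'a \<Rightarrow> 'a \<Rightarrow> 'k::field"
  assumes finite_group: "finite (carrier G)"
    and cocycle: "normalized_2cocycle G \<alpha>"
begin

abbreviation "A \<equiv> twisted_group_algebra G \<alpha>"

lemma cocycle_nonzero: "x \<in> carrier G \<Longrightarrow> y \<in> carrier G \<Longrightarrow> \<alpha> x y \<noteq> 0"
  and cocycle_eq: "x \<in> carrier G \<Longrightarrow> y \<in> carrier G \<Longrightarrow> z \<in> carrier G \<Longrightarrow>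
        \<alpha> x (y \<otimes> z) * \<alpha> y z = \<alpha> (x \<otimes> y) z * \<alpha> x y"
  and cocycle_one: "x \<in> carrier G \<Longrightarrow> \<alpha> x \<one> = 1" "x \<in> carrier G \<Longrightarrow> \<alpha> \<one> x = 1"
  using cocycle by (auto simp: normalized_2cocycle_def)

lemma basis_elem_closed [simp]: "g \<in> carrier G \<Longrightarrow> (basis_elem g :: _ \<Rightarrow> 'k) \<in> carrier A"
  by (auto simp: twisted_group_algebra_def basis_elem_def)

lemma mult_eq:
  "(a \<otimes>\<^bsub>A\<^esub> b) = (\<lambda>x. \<Sum>g\<in>carrier G. \<Sum>h\<in>carrier G. if g \<otimes> h = x then a g * b h * \<alpha> g h else 0)"
  by (simp add: twisted_group_algebra_def)

lemma mult_closed_A: "a \<otimes>\<^bsub>A\<^esub> b \<in> carrier A"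
  by (auto simp: twisted_group_algebra_def intro!: sum.neutral)

lemma mult_basis_elem:
  assumes "g \<in> carrier G" "h \<in> carrier G"
  shows "basis_elem g \<otimes>\<^bsub>A\<^esub> basis_elem h = \<alpha> g h \<odot>\<^bsub>A\<^esub> basis_elem (g \<otimes> h)"
proof
  fix x
  have "(basis_elem g \<otimes>\<^bsub>A\<^esub> basis_elem h) x =
     (\<Sum>g'\<in>carrier G. \<Sum>h'\<in>carrier G. if h' = h then if g' = g then if g \<otimes> h = x then \<alpha> g h else 0 else 0 else 0)"
    unfolding mult_eq by (intro sum.cong refl) (simp add: basis_elem_def)
  also have "\<dots> = (if g \<otimes> h = x then \<alpha> g h else 0)"
    using assms by (simp add: sum.delta finite_group)
  finally show "(basis_elem g \<otimes>\<^bsub>A\<^esub> basis_elem h) x = (\<alpha> g h \<odot>\<^bsub>A\<^esub> basis_elem (g \<otimes> h)) x"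
    by (auto simp: twisted_group_algebra_def basis_elem_def)
qed

lemma mult_assoc_A: "(a \<otimes>\<^bsub>A\<^esub> b) \<otimes>\<^bsub>A\<^esub> c = a \<otimes>\<^bsub>A\<^esub> (b \<otimes>\<^bsub>A\<^esub> c)"
proof
  fix x
  let ?G = "carrier G"
  have "((a \<otimes>\<^bsub>A\<^esub> b) \<otimes>\<^bsub>A\<^esub> c) x =
    (\<Sum>u\<in>?G. \<Sum>l\<in>?G. \<Sum>g\<in>?G. \<Sum>h\<in>?G. if g \<otimes> h = u then
        if u \<otimes> l = x then a g * b h * \<alpha> g h * c l * \<alpha> u l else 0 else 0)"
    unfolding mult_eq by (intro sum.cong refl) (auto simp: sum_distrib_right intro!: sum.cong sum.neutral)
  also have "\<dots> = (\<Sum>l\<in>?G. \<Sum>g\<in>?G. \<Sum>h\<in>?G. \<Sum>u\<in>?G. if g \<otimes> h = u then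
        if u \<otimes> l = x then a g * b h * \<alpha> g h * c l * \<alpha> u l else 0 else 0)"
    by (subst sum.swap, rule sum.cong[OF refl], subst sum.swap, rule sum.cong[OF refl], subst sum.swap, rule refl)
  also have "\<dots> = (\<Sum>l\<in>?G. \<Sum>g\<in>?G. \<Sum>h\<in>?G. 
        if (g \<otimes> h) \<otimes> l = x then a g * b h * \<alpha> g h * c l * \<alpha> (g \<otimes> h) l else 0)"
    by (intro sum.cong refl) (simp add: sum.delta' finite_group)
  also have "\<dots> = (\<Sum>l\<in>?G. \<Sum>g\<in>?G. \<Sum>h\<in>?G. 
        if g \<otimes> (h \<otimes> l) = x then a g * (b h * c l * \<alpha> h l) * \<alpha> g (h \<otimes> l) else 0)"
  proof (intro sum.cong refl)
    fix l g h assume H: "l \<in> ?G" "g \<in> ?G" "h \<in> ?G"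
    have "a g * b h * \<alpha> g h * c l * \<alpha> (g \<otimes> h) l = a g * b h * c l * (\<alpha> (g \<otimes> h) l * \<alpha> g h)"
      by (simp add: mult_ac)
    also have "\<dots> = a g * (b h * c l * \<alpha> h l) * \<alpha> g (h \<otimes> l)"
      by (subst cocycle_eq[symmetric]) (use H in \<open>auto simp: mult_ac\<close>)
    finally show "(if (g \<otimes> h) \<otimes> l = x then a g * b h * \<alpha> g h * c l * \<alpha> (g \<otimes> h) l else 0) =
       (if g \<otimes> (h \<otimes> l) = x then a g * (b h * c l * \<alpha> h l) * \<alpha> g (h \<otimes> l) else 0)"
      using H by (simp add: m_assoc)
  qed
  also have "\<dots> = (\<Sum>g\<in>?G. \<Sum>h\<in>?G. \<Sum>l\<in>?G.
        if g \<otimes> (h \<otimes> l) = x then a g * (b h * c l * \<alpha> h l) * \<alpha> g (h \<otimes> l) else 0)"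
    by (subst sum.swap, rule sum.cong[OF refl], rule sum.swap)
  also have "\<dots> = (\<Sum>g\<in>?G. \<Sum>h\<in>?G. \<Sum>l\<in>?G. \<Sum>u\<in>?G. if h \<otimes> l = u then
        if g \<otimes> u = x then a g * (b h * c l * \<alpha> h l) * \<alpha> g u else 0 else 0)"
    by (intro sum.cong refl) (simp add: sum.delta' finite_group)
  also have "\<dots> = (\<Sum>g\<in>?G. \<Sum>u\<in>?G. \<Sum>h\<in>?G. \<Sum>l\<in>?G. if h \<otimes> l = u then
        if g \<otimes> u = x then a g * (b h * c l * \<alpha> h l) * \<alpha> g u else 0 else 0)"
    by (rule sum.cong[OF refl], subst (2) sum.swap, rule sum.cong[OF refl], rule sum.swap)
  also have "\<dots> = (a \<otimes>\<^bsub>A\<^esub> (b \<otimes>\<^bsub>A\<^esub> c)) x"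
    unfolding mult_eq
    by (intro sum.cong refl) (auto simp: sum_distrib_right sum_distrib_left intro!: sum.cong sum.neutral)
  finally show "((a \<otimes>\<^bsub>A\<^esub> b) \<otimes>\<^bsub>A\<^esub> c) x = (a \<otimes>\<^bsub>A\<^esub> (b \<otimes>\<^bsub>A\<^esub> c)) x" .
qed

lemma mult_one_A:
  assumes "a \<in> carrier A" shows "\<one>\<^bsub>A\<^esub> \<otimes>\<^bsub>A\<^esub> a = a" "a \<otimes>\<^bsub>A\<^esub> \<one>\<^bsub>A\<^esub> = a"
proof -
  have a: "a x = 0" if "x \<notin> carrier G" for x
    using assms that by (auto simp: twisted_group_algebra_def)
  show "\<one>\<^bsub>A\<^esub> \<otimes>\<^bsub>A\<^esub> a = a"
  proof
    fix x
    have "(\<one>\<^bsub>A\<^esub> \<otimes>\<^bsub>A\<^esub> a) x = (\<Sum>g\<in>carrier G. \<Sum>h\<in>carrier G. if h = x then if g = \<one> then a x else 0 else 0)"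
      unfolding mult_eq
      by (intro sum.cong refl) (auto simp: twisted_group_algebra_def basis_elem_def cocycle_one)
    also have "\<dots> = a x" by (cases "x \<in> carrier G") (auto simp: sum.delta finite_group a)
    finally show "(\<one>\<^bsub>A\<^esub> \<otimes>\<^bsub>A\<^esub> a) x = a x" .
  qed
  show "a \<otimes>\<^bsub>A\<^esub> \<one>\<^bsub>A\<^esub> = a"
  proof
    fix x
    have "(a \<otimes>\<^bsub>A\<^esub> \<one>\<^bsub>A\<^esub>) x = (\<Sum>g\<in>carrier G. \<Sum>h\<in>carrier G. if h = \<one> then if g = x then a x else 0 else 0)"
      unfolding mult_eq
      by (intro sum.cong refl) (auto simp: twisted_group_algebra_def basis_elem_def cocycle_one)
    also have "\<dots> = a x" by (cases "x \<in> carrier G") (auto simp: sum.delta finite_group a)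
    finally show "(a \<otimes>\<^bsub>A\<^esub> \<one>\<^bsub>A\<^esub>) x = a x" .
  qed
qed

lemma add_A: "a \<oplus>\<^bsub>A\<^esub> b = (\<lambda>x. a x + b x)"
  and smult_A: "c \<odot>\<^bsub>A\<^esub> a = (\<lambda>x. c * a x)"
  and zero_A: "\<zero>\<^bsub>A\<^esub> = (\<lambda>x. 0)"
  by (simp_all add: twisted_group_algebra_def)

lemma add_closed_A [simp]: "a \<in> carrier A \<Longrightarrow> b \<in> carrier A \<Longrightarrow> a \<oplus>\<^bsub>A\<^esub> b \<in> carrier A"
  and smult_closed_A [simp]: "a \<in> carrier A \<Longrightarrow> c \<odot>\<^bsub>A\<^esub> a \<in> carrier A"
  by (simp_all add: twisted_group_algebra_def)

lemma mult_add_A: "(a \<oplus>\<^bsub>A\<^esub> b) \<otimes>\<^bsub>A\<^esub> c = (a \<otimes>\<^bsub>A\<^esub> c) \<oplus>\<^bsub>A\<^esub> (b \<otimes>\<^bsub>A\<^esub> c)"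
  "c \<otimes>\<^bsub>A\<^esub> (a \<oplus>\<^bsub>A\<^esub> b) = (c \<otimes>\<^bsub>A\<^esub> a) \<oplus>\<^bsub>A\<^esub> (c \<otimes>\<^bsub>A\<^esub> b)"
  unfolding mult_eq add_A
  by (intro ext; simp add: sum.distrib[symmetric]; intro sum.cong refl; simp add: algebra_simps)+

lemma mult_smult_A: "(r \<odot>\<^bsub>A\<^esub> a) \<otimes>\<^bsub>A\<^esub> c = r \<odot>\<^bsub>A\<^esub> (a \<otimes>\<^bsub>A\<^esub> c)"
  "c \<otimes>\<^bsub>A\<^esub> (r \<odot>\<^bsub>A\<^esub> a) = r \<odot>\<^bsub>A\<^esub> (c \<otimes>\<^bsub>A\<^esub> a)"
  unfolding mult_eq smult_A
  by (intro ext; simp add: sum_distrib_left; intro sum.cong refl; simp add: algebra_simps)+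

lemma ring_A: "ring A"
proof (rule ringI)
  show "abelian_group A"
  proof (rule abelian_groupI)
    fix x assume x: "x \<in> carrier A"
    show "\<exists>y\<in>carrier A. y \<oplus>\<^bsub>A\<^esub> x = \<zero>\<^bsub>A\<^esub>"
      by (rule bexI[of _ "\<lambda>g. - x g"]) (use x in \<open>auto simp: twisted_group_algebra_def\<close>)
  qed (auto simp: twisted_group_algebra_def algebra_simps)
  show "Group.monoid A"
    by (rule monoidI) (auto simp: mult_closed_A mult_assoc_A mult_one_A, simp add: twisted_group_algebra_def basis_elem_def)
qed (simp_all only: mult_add_A)

lemma inv_basis_elem:
  assumes g: "g \<in> carrier G"
  shows "basis_elem g \<in> Units A"
    and "inv\<^bsub>A\<^esub> (basis_elem g) = inverse (\<alpha> g (inv g)) \<odot>\<^bsub>A\<^esub> basis_elem (inv g)"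
proof -
  interpret A: ring A by (rule ring_A)
  let ?b = "inverse (\<alpha> g (inv g)) \<odot>\<^bsub>A\<^esub> basis_elem (inv g)"
  have "\<alpha> g (inv g) = \<alpha> (inv g) g"
    using cocycle_eq[of g "inv g" g] g by (simp add: cocycle_one)
  moreover have "inverse c \<odot>\<^bsub>A\<^esub> (c \<odot>\<^bsub>A\<^esub> basis_elem \<one>) = \<one>\<^bsub>A\<^esub>" if "c \<noteq> 0" for c
    using that by (simp add: twisted_group_algebra_def mult.assoc[symmetric])
  ultimately have *: "basis_elem g \<otimes>\<^bsub>A\<^esub> ?b = \<one>\<^bsub>A\<^esub>" "?b \<otimes>\<^bsub>A\<^esub> basis_elem g = \<one>\<^bsub>A\<^esub>"
    using g cocycle_nonzero[of g "inv g"] by (simp_all add: mult_smult_A mult_basis_elem)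
  show "basis_elem g \<in> Units A"
    using * g unfolding Units_def by (auto intro!: bexI[of _ ?b])
  show "inv\<^bsub>A\<^esub> (basis_elem g) = ?b"
    using * g by (intro A.inv_unique'[symmetric]) auto
qed

end


section \<open>Bimodules\<close>

text \<open>Both actions are bilinear over the ground field, i.e. \<open>k\<close> acts centrally.\<close>

locale bimodule = vector_space scale
  for A :: "('k::field, 'a) module"
    and scale :: "'k \<Rightarrow> 'm::ab_group_add \<Rightarrow> 'm"
    and lact :: "'a \<Rightarrow> 'm \<Rightarrow> 'm"
    and ract :: "'m \<Rightarrow> 'a \<Rightarrow> 'm" +
  assumes lact_add_right: "a \<in> carrier A \<Longrightarrow> lact a (u + v) = lact a u + lact a v"
    and lact_scale_right: "a \<in> carrier A \<Longrightarrow> lact a (scale c u) = scale c (lact a u)"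
    and lact_add_left: "a \<in> carrier A \<Longrightarrow> b \<in> carrier A \<Longrightarrow> lact (a \<oplus>\<^bsub>A\<^esub> b) u = lact a u + lact b u"
    and lact_scale_left: "a \<in> carrier A \<Longrightarrow> lact (c \<odot>\<^bsub>A\<^esub> a) u = scale c (lact a u)"
    and lact_mult: "a \<in> carrier A \<Longrightarrow> b \<in> carrier A \<Longrightarrow> lact (a \<otimes>\<^bsub>A\<^esub> b) u = lact a (lact b u)"
    and lact_one: "lact \<one>\<^bsub>A\<^esub> u = u"
    and ract_add_left: "a \<in> carrier A \<Longrightarrow> ract (u + v) a = ract u a + ract v a"
    and ract_scale_left: "a \<in> carrier A \<Longrightarrow> ract (scale c u) a = scale c (ract u a)"
    and ract_add_right: "a \<in> carrier A \<Longrightarrow> b \<in> carrier A \<Longrightarrow> ract u (a \<oplus>\<^bsub>A\<^esub> b) = ract u a + ract u b"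
    and ract_scale_right: "a \<in> carrier A \<Longrightarrow> ract u (c \<odot>\<^bsub>A\<^esub> a) = scale c (ract u a)"
    and ract_mult: "a \<in> carrier A \<Longrightarrow> b \<in> carrier A \<Longrightarrow> ract u (a \<otimes>\<^bsub>A\<^esub> b) = ract (ract u a) b"
    and ract_one: "ract u \<one>\<^bsub>A\<^esub> = u"
    and lact_ract: "a \<in> carrier A \<Longrightarrow> b \<in> carrier A \<Longrightarrow> ract (lact a u) b = lact a (ract u b)"


section \<open>Tensor powers and Hochschild cochains\<close>

definition tuples :: "('g, 'z) monoid_scheme \<Rightarrow> nat \<Rightarrow> 'g list set" where
  "tuples G n = {gs. length gs = n \<and> set gs \<subseteq> carrier G}"

text \<open>
  The tensor power \<open>(k\<^sub>\<alpha>G)\<^sup>\<otimes>\<^sup>n\<close> is modelled as the space of coefficient functions \<open>G\<^sup>n \<rightarrow> k\<close> with respect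
  to the basis \<open>g\<^sub>1 \<otimes> \<dots> \<otimes> g\<^sub>n\<close>, and \<open>pure_tensor [a\<^sub>1, \<dots>, a\<^sub>n]\<close> is \<open>a\<^sub>1 \<otimes> \<dots> \<otimes> a\<^sub>n\<close>. That this has the
  universal property of the tensor product is the theorem \<open>tensor_power_universal\<close> below.
\<close>

definition tensor_power :: "('g, 'z) monoid_scheme \<Rightarrow> nat \<Rightarrow> ('g list \<Rightarrow> 'k::field) set" where
  "tensor_power G n = {t. \<forall>gs. gs \<notin> tuples G n \<longrightarrow> t gs = 0}"

definition pure_tensor :: "('g \<Rightarrow> 'k::field) list \<Rightarrow> 'g list \<Rightarrow> 'k" where
  "pure_tensor as gs = (if length gs = length as then \<Prod>i<length as. (as ! i) (gs ! i) else 0)"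

definition linear_map_on ::
  "('i \<Rightarrow> 'k::field) set \<Rightarrow> ('k \<Rightarrow> 'm::ab_group_add \<Rightarrow> 'm) \<Rightarrow> (('i \<Rightarrow> 'k) \<Rightarrow> 'm) \<Rightarrow> bool" where
  "linear_map_on V scale \<phi> \<longleftrightarrow>
     (\<forall>s\<in>V. \<forall>t\<in>V. \<phi> (\<lambda>x. s x + t x) = \<phi> s + \<phi> t) \<and>
     (\<forall>c. \<forall>t\<in>V. \<phi> (\<lambda>x. c * t x) = scale c (\<phi> t))"

text \<open>
  \<open>Hom\<^sub>k((k\<^sub>\<alpha>G)\<^sup>\<otimes>\<^sup>n, M)\<close>; extensionality makes equality of cochains the equality on the tensor power.
\<close>

definition cochains ::
  "('g, 'z) monoid_scheme \<Rightarrow> ('k::field \<Rightarrow> 'm::ab_group_add \<Rightarrow> 'm) \<Rightarrow> nat \<Rightarrow> (('g list \<Rightarrow> 'k) \<Rightarrow> 'm) set" where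
  "cochains G scale n =
     {\<phi> \<in> extensional (tensor_power G n). linear_map_on (tensor_power G n) scale \<phi>}"

definition multilinear_on ::
  "('k::field, 'a) module \<Rightarrow> ('k \<Rightarrow> 'm::ab_group_add \<Rightarrow> 'm) \<Rightarrow> nat \<Rightarrow> ('a list \<Rightarrow> 'm) \<Rightarrow> bool" where
  "multilinear_on A scale n F \<longleftrightarrow>
     (\<forall>us vs. length us + length vs + 1 = n \<and> set us \<subseteq> carrier A \<and> set vs \<subseteq> carrier A \<longrightarrow>
        (\<forall>a\<in>carrier A. \<forall>b\<in>carrier A.
           F (us @ (a \<oplus>\<^bsub>A\<^esub> b) # vs) = F (us @ a # vs) + F (us @ b # vs)) \<and>
        (\<forall>c. \<forall>a\<in>carrier A. F (us @ (c \<odot>\<^bsub>A\<^esub> a) # vs) = scale c (F (us @ a # vs))))"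

definition linear_extension ::
  "('g, 'z) monoid_scheme \<Rightarrow> ('k::field \<Rightarrow> 'm::ab_group_add \<Rightarrow> 'm) \<Rightarrow> nat \<Rightarrow>
    ('g list \<Rightarrow> 'm) \<Rightarrow> ('g list \<Rightarrow> 'k) \<Rightarrow> 'm" where
  "linear_extension G scale n F =
     (\<lambda>t\<in>tensor_power G n. \<Sum>gs\<in>tuples G n. scale (t gs) (F gs))"

lemma multilinear_onI:
  assumes "\<And>us vs a b. length us + length vs + 1 = n \<Longrightarrow> set us \<subseteq> carrier A \<Longrightarrow> set vs \<subseteq> carrier A \<Longrightarrow>
      a \<in> carrier A \<Longrightarrow> b \<in> carrier A \<Longrightarrow> F (us @ (a \<oplus>\<^bsub>A\<^esub> b) # vs) = F (us @ a # vs) + F (us @ b # vs)"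
    and "\<And>us vs a c. length us + length vs + 1 = n \<Longrightarrow> set us \<subseteq> carrier A \<Longrightarrow> set vs \<subseteq> carrier A \<Longrightarrow>
      a \<in> carrier A \<Longrightarrow> F (us @ (c \<odot>\<^bsub>A\<^esub> a) # vs) = scale c (F (us @ a # vs))"
  shows "multilinear_on A scale n F"
  using assms unfolding multilinear_on_def by simp

lemma multilinear_onD:
  assumes "multilinear_on A scale n F"
    and "length us + length vs + 1 = n" "set us \<subseteq> carrier A" "set vs \<subseteq> carrier A" "a \<in> carrier A"
  shows "b \<in> carrier A \<Longrightarrow> F (us @ (a \<oplus>\<^bsub>A\<^esub> b) # vs) = F (us @ a # vs) + F (us @ b # vs)"
    and "F (us @ (c \<odot>\<^bsub>A\<^esub> a) # vs) = scale c (F (us @ a # vs))"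
  using assms unfolding multilinear_on_def by blast+

lemma tuples_0 [simp]: "tuples G 0 = {[]}"
  by (auto simp: tuples_def)

lemma tuples_Suc: "tuples G (Suc n) = (\<lambda>(g, gs). g # gs) ` (carrier G \<times> tuples G n)"
  by (auto simp: tuples_def length_Suc_conv image_iff)

lemma sum_tuples_Suc:
  "(\<Sum>gs\<in>tuples G (Suc n). f gs) = (\<Sum>g\<in>carrier G. \<Sum>gs\<in>tuples G n. f (g # gs))"
proof -
  have "(\<Sum>gs\<in>tuples G (Suc n). f gs) = (\<Sum>(g, gs)\<in>carrier G \<times> tuples G n. f (g # gs))"
    unfolding tuples_Suc by (subst sum.reindex) (auto simp: inj_on_def case_prod_unfold)
  thus ?thesis by (simp add: sum.cartesian_product)
qed

lemma pure_tensor_simps [simp]: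
  "pure_tensor [] [] = 1"
  "pure_tensor (a # as) [] = 0"
  "pure_tensor [] (g # gs) = 0"
  "pure_tensor (a # as) (g # gs) = a g * pure_tensor as gs"
  by (simp_all add: pure_tensor_def prod.lessThan_Suc_shift del: prod.lessThan_Suc)

lemma pure_tensor_basis_elem: "pure_tensor (map basis_elem gs) = basis_elem gs"
proof
  show "pure_tensor (map basis_elem gs) hs = basis_elem gs hs" for hs :: "'a list"
  proof (induction gs arbitrary: hs)
    case Nil show ?case by (cases hs) (auto simp: basis_elem_def)
  next
    case (Cons g gs) thus ?case by (cases hs) (auto simp: basis_elem_def)
  qed
qed

locale twisted_bimodule = twisted_group G \<alpha> +
  bimodule "twisted_group_algebra G \<alpha>" scale lact ract
  for G (structure) and \<alpha> :: "'g \<Rightarrow> 'g \<Rightarrow> 'k::field"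
    and scale :: "'k \<Rightarrow> 'm::ab_group_add \<Rightarrow> 'm"
    and lact :: "('g \<Rightarrow> 'k) \<Rightarrow> 'm \<Rightarrow> 'm" and ract :: "'m \<Rightarrow> ('g \<Rightarrow> 'k) \<Rightarrow> 'm"
begin

lemma finite_tuples: "finite (tuples G n)"
  using finite_lists_length_eq[OF finite_group, of n] by (simp add: tuples_def conj_commute)

lemma pure_tensor_closed:
  assumes "set as \<subseteq> carrier A" "length as = n"
  shows "pure_tensor as \<in> tensor_power G n"
proof -
  have "pure_tensor as gs = 0" if "gs \<notin> tuples G (length as)" for gs
    using assms(1) that
  proof (induction as arbitrary: gs)
    case Nil thus ?case by (cases gs) auto
  next
    case (Cons a as)
    show ?case
    proof (cases gs)
      case (Cons h hs)
      hence "h \<notin> carrier G \<or> hs \<notin> tuples G (length as)"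
        using Cons.prems by (auto simp: tuples_def)
      thus ?thesis
        using Cons Cons.IH[of hs] Cons.prems by (auto simp: twisted_group_algebra_def)
    qed simp
  qed
  thus ?thesis using assms(2) by (auto simp: tensor_power_def)
qed

lemma pure_tensor_add:
  "pure_tensor (us @ (a \<oplus>\<^bsub>A\<^esub> b) # vs) = (\<lambda>gs. pure_tensor (us @ a # vs) gs + pure_tensor (us @ b # vs) gs)"
proof
  show "pure_tensor (us @ (a \<oplus>\<^bsub>A\<^esub> b) # vs) gs = pure_tensor (us @ a # vs) gs + pure_tensor (us @ b # vs) gs" for gs
  proof (induction us arbitrary: gs)
    case Nil show ?case by (cases gs) (auto simp: add_A algebra_simps)
  next
    case (Cons u us) thus ?case by (cases gs) (auto simp: algebra_simps)
  qed
qed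

lemma pure_tensor_smult:
  "pure_tensor (us @ (c \<odot>\<^bsub>A\<^esub> a) # vs) = (\<lambda>gs. c * pure_tensor (us @ a # vs) gs)"
proof
  show "pure_tensor (us @ (c \<odot>\<^bsub>A\<^esub> a) # vs) gs = c * pure_tensor (us @ a # vs) gs" for gs
  proof (induction us arbitrary: gs)
    case Nil show ?case by (cases gs) (auto simp: smult_A algebra_simps)
  next
    case (Cons u us) thus ?case by (cases gs) (auto simp: algebra_simps)
  qed
qed

lemma multilinear_pure_tensor:
  assumes "\<phi> \<in> cochains G scale n"
  shows "multilinear_on A scale n (\<lambda>as. \<phi> (pure_tensor as))"
proof (rule multilinear_onI)
  fix us vs :: "('g \<Rightarrow> 'k) list" and a b
  assume H: "length us + length vs + 1 = n" "set us \<subseteq> carrier A" "set vs \<subseteq> carrier A" "a \<in> carrier A"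
  hence 1: "pure_tensor (us @ a # vs) \<in> tensor_power G n"
    by (intro pure_tensor_closed) auto
  show "\<phi> (pure_tensor (us @ (c \<odot>\<^bsub>A\<^esub> a) # vs)) = scale c (\<phi> (pure_tensor (us @ a # vs)))" for c
    using 1 assms by (simp add: pure_tensor_smult cochains_def linear_map_on_def)
  assume "b \<in> carrier A"
  hence "pure_tensor (us @ b # vs) \<in> tensor_power G n"
    using H by (intro pure_tensor_closed) auto
  thus "\<phi> (pure_tensor (us @ (a \<oplus>\<^bsub>A\<^esub> b) # vs)) = \<phi> (pure_tensor (us @ a # vs)) + \<phi> (pure_tensor (us @ b # vs))"
    using 1 assms by (simp add: pure_tensor_add cochains_def linear_map_on_def)
qed

lemma multilinear_expand_one:
  assumes F: "multilinear_on A scale n F" and H: "length us + length vs + 1 = n"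
    "set us \<subseteq> carrier A" "set vs \<subseteq> carrier A" and a: "a \<in> carrier A"
  shows "F (us @ a # vs) = (\<Sum>g\<in>carrier G. scale (a g) (F (us @ basis_elem g # vs)))"
proof -
  have "F (us @ (\<lambda>x. if x \<in> S then a x else 0) # vs) = (\<Sum>g\<in>S. scale (a g) (F (us @ basis_elem g # vs)))"
    if "finite S" "S \<subseteq> carrier G" for S
    using that
  proof (induction S rule: finite_induct)
    case empty
    have "(\<lambda>x. 0) = 0 \<odot>\<^bsub>A\<^esub> a" by (simp add: smult_A)
    thus ?case using multilinear_onD(2)[OF F H a, of 0] by simp
  next
    case (insert g S)
    have "(\<lambda>x. if x \<in> insert g S then a x else 0) =
        (a g \<odot>\<^bsub>A\<^esub> basis_elem g) \<oplus>\<^bsub>A\<^esub> (\<lambda>x. if x \<in> S then a x else 0)"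
      using insert.hyps by (auto simp: smult_A add_A basis_elem_def fun_eq_iff)
    moreover have "(\<lambda>x. if x \<in> S then a x else 0) \<in> carrier A"
      using insert.prems a by (auto simp: twisted_group_algebra_def)
    ultimately show ?case
      using insert by (simp add: multilinear_onD[OF F H])
  qed
  moreover have "(\<lambda>x. if x \<in> carrier G then a x else 0) = a"
    using a by (auto simp: twisted_group_algebra_def fun_eq_iff)
  ultimately show ?thesis using finite_group by force
qed

lemma multilinear_expand:
  assumes F: "multilinear_on A scale n F" and "length us + length as = n"
    "set us \<subseteq> carrier A" "set as \<subseteq> carrier A"
  shows "F (us @ as) = (\<Sum>gs\<in>tuples G (length as). scale (pure_tensor as gs) (F (us @ map basis_elem gs)))"
  using assms(2-)
proof (induction as arbitrary: us)
  case Nil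
  show ?case by simp
next
  case (Cons a as)
  have "F (us @ a # as) = (\<Sum>g\<in>carrier G. scale (a g) (F (us @ basis_elem g # as)))"
    using Cons.prems by (intro multilinear_expand_one[OF F]) auto
  also have "\<dots> = (\<Sum>g\<in>carrier G. scale (a g) (\<Sum>gs\<in>tuples G (length as).
      scale (pure_tensor as gs) (F (us @ map basis_elem (g # gs)))))"
  proof (intro sum.cong refl arg_cong[where f = "scale _"])
    fix g assume "g \<in> carrier G"
    thus "F (us @ basis_elem g # as) = (\<Sum>gs\<in>tuples G (length as).
      scale (pure_tensor as gs) (F (us @ map basis_elem (g # gs))))"
      using Cons.IH[of "us @ [basis_elem g]"] Cons.prems by simp
  qed
  finally show ?case
    by (simp add: sum_tuples_Suc scale_sum_right)
qed

lemma linear_map_expand: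
  assumes \<psi>: "linear_map_on (tensor_power G n) scale \<psi>" and t: "t \<in> tensor_power G n"
  shows "\<psi> t = (\<Sum>gs\<in>tuples G n. scale (t gs) (\<psi> (basis_elem gs)))"
proof -
  have sc: "\<psi> (\<lambda>x. c * t x) = scale c (\<psi> t)" if "t \<in> tensor_power G n" for c t
    using \<psi> that by (auto simp: linear_map_on_def)
  have "\<psi> (\<lambda>x. if x \<in> S then t x else 0) = (\<Sum>gs\<in>S. scale (t gs) (\<psi> (basis_elem gs)))"
    if "finite S" "S \<subseteq> tuples G n" for S
    using that
  proof (induction S rule: finite_induct)
    case empty
    thus ?case using sc[OF t, of 0] by simp
  next
    case (insert g S)
    have b: "basis_elem g \<in> tensor_power G n"
      using insert.prems by (auto simp: tensor_power_def basis_elem_def)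
    have "(\<lambda>x. if x \<in> insert g S then t x else 0) =
        (\<lambda>x. t g * basis_elem g x + (if x \<in> S then t x else 0))"
      using insert.hyps by (auto simp: basis_elem_def fun_eq_iff)
    moreover have "(\<lambda>x. if x \<in> S then t x else 0) \<in> tensor_power G n"
      using t by (auto simp: tensor_power_def)
    moreover have "(\<lambda>x. t g * basis_elem g x) \<in> tensor_power G n"
      using b by (auto simp: tensor_power_def)
    ultimately have "\<psi> (\<lambda>x. if x \<in> insert g S then t x else 0) =
        \<psi> (\<lambda>x. t g * basis_elem g x) + \<psi> (\<lambda>x. if x \<in> S then t x else 0)"
      using \<psi> by (simp add: linear_map_on_def)
    thus ?case using insert sc[OF b] by simp
  qed
  moreover have "(\<lambda>x. if x \<in> tuples G n then t x else 0) = t"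
    using t by (auto simp: tensor_power_def fun_eq_iff)
  ultimately show ?thesis using finite_tuples[of n] by fastforce
qed

lemma linear_extension_closed: "linear_extension G scale n F \<in> cochains G scale n"
proof -
  have "(\<lambda>x. s x + t x) \<in> tensor_power G n" "(\<lambda>x. c * t x) \<in> tensor_power G n"
    if "s \<in> tensor_power G n" "t \<in> tensor_power G n" for s t :: "'g list \<Rightarrow> 'k" and c
    using that by (auto simp: tensor_power_def)
  thus ?thesis
    by (auto simp: cochains_def linear_extension_def linear_map_on_def scale_left_distrib
        sum.distrib scale_sum_right)
qed

lemma linear_extension_basis_elem:
  assumes "gs \<in> tuples G n"
  shows "linear_extension G scale n F (pure_tensor (map basis_elem gs)) = F gs"
proof -
  have "(basis_elem gs :: _ \<Rightarrow> 'k) \<in> tensor_power G n"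
    using assms by (auto simp: tensor_power_def basis_elem_def)
  moreover have "(\<Sum>hs\<in>tuples G n. scale (basis_elem gs hs) (F hs)) =
      (\<Sum>hs\<in>tuples G n. if hs = gs then F hs else 0)"
    by (intro sum.cong) (auto simp: basis_elem_def)
  ultimately show ?thesis
    using assms finite_tuples[of n] by (simp add: linear_extension_def pure_tensor_basis_elem)
qed

theorem tensor_power_universal:
  assumes F: "multilinear_on A scale n F"
  shows "\<exists>!\<psi>. \<psi> \<in> cochains G scale n \<and>
    (\<forall>as. length as = n \<and> set as \<subseteq> carrier A \<longrightarrow> \<psi> (pure_tensor as) = F as)"
proof (rule ex1I)
  show "linear_extension G scale n (\<lambda>gs. F (map basis_elem gs)) \<in> cochains G scale n \<and>
    (\<forall>as. length as = n \<and> set as \<subseteq> carrier A \<longrightarrow>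
       linear_extension G scale n (\<lambda>gs. F (map basis_elem gs)) (pure_tensor as) = F as)"
    using linear_extension_closed multilinear_expand[OF F, of "[]"]
    by (auto simp: linear_extension_def pure_tensor_closed)
next
  fix \<psi>
  assume \<psi>: "\<psi> \<in> cochains G scale n \<and>
    (\<forall>as. length as = n \<and> set as \<subseteq> carrier A \<longrightarrow> \<psi> (pure_tensor as) = F as)"
  have *: "\<psi> (basis_elem gs) = F (map basis_elem gs)" if "gs \<in> tuples G n" for gs
  proof -
    have "set (map basis_elem gs) \<subseteq> carrier A" "length (map basis_elem gs) = n"
      using that by (auto simp: tuples_def)
    thus ?thesis using \<psi> by (metis pure_tensor_basis_elem)
  qed
  show "\<psi> = linear_extension G scale n (\<lambda>gs. F (map basis_elem gs))"
  proof (rule extensionalityI[of _ "tensor_power G n"])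
    show "\<psi> t = linear_extension G scale n (\<lambda>gs. F (map basis_elem gs)) t" if "t \<in> tensor_power G n" for t
      using linear_map_expand[of n \<psi> t] \<psi> that * by (simp add: linear_extension_def cochains_def)
  qed (use \<psi> in \<open>auto simp: cochains_def linear_extension_def\<close>)
qed

end

text \<open>
  The differential is the unique linear map with the prescribed values on pure tensors;
  see \<open>hochschild_diff0\<close> and \<open>hochschild_diff\<close> below for existence. In degree \<open>0\<close> a cochain is an element of \<open>M\<close>.
  Lists are indexed from \<open>0\<close>, so that \<open>a\<^sub>j\<close> is \<open>as ! (j - 1)\<close>.
\<close>

definition hochschild_diff0 ::
  "('g, 'z) monoid_scheme \<Rightarrow> ('g \<Rightarrow> 'g \<Rightarrow> 'k::field) \<Rightarrow> ('k \<Rightarrow> 'm::ab_group_add \<Rightarrow> 'm) \<Rightarrow>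
    (('g \<Rightarrow> 'k) \<Rightarrow> 'm \<Rightarrow> 'm) \<Rightarrow> ('m \<Rightarrow> ('g \<Rightarrow> 'k) \<Rightarrow> 'm) \<Rightarrow> 'm \<Rightarrow> ('g list \<Rightarrow> 'k) \<Rightarrow> 'm" where
  "hochschild_diff0 G \<alpha> scale lact ract m =
     (THE \<psi>. \<psi> \<in> cochains G scale 1 \<and>
        (\<forall>a\<in>carrier (twisted_group_algebra G \<alpha>). \<psi> (pure_tensor [a]) = lact a m - ract m a))"

definition hochschild_diff_formula ::
  "('k::field, 'g \<Rightarrow> 'k) module \<Rightarrow> ('k \<Rightarrow> 'm::ab_group_add \<Rightarrow> 'm) \<Rightarrow>
    (('g \<Rightarrow> 'k) \<Rightarrow> 'm \<Rightarrow> 'm) \<Rightarrow> ('m \<Rightarrow> ('g \<Rightarrow> 'k) \<Rightarrow> 'm) \<Rightarrow>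
    nat \<Rightarrow> (('g list \<Rightarrow> 'k) \<Rightarrow> 'm) \<Rightarrow> ('g \<Rightarrow> 'k) list \<Rightarrow> 'm" where
  "hochschild_diff_formula A scale lact ract n \<phi> as =
     lact (hd as) (\<phi> (pure_tensor (tl as)))
     + (\<Sum>j=1..n. scale ((-1) ^ j)
          (\<phi> (pure_tensor (take (j - 1) as @ (as ! (j - 1) \<otimes>\<^bsub>A\<^esub> as ! j) # drop (j + 1) as))))
     + scale ((-1) ^ (n + 1)) (ract (\<phi> (pure_tensor (butlast as))) (last as))"

definition hochschild_diff ::
  "('g, 'z) monoid_scheme \<Rightarrow> ('g \<Rightarrow> 'g \<Rightarrow> 'k::field) \<Rightarrow> ('k \<Rightarrow> 'm::ab_group_add \<Rightarrow> 'm) \<Rightarrow>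
    (('g \<Rightarrow> 'k) \<Rightarrow> 'm \<Rightarrow> 'm) \<Rightarrow> ('m \<Rightarrow> ('g \<Rightarrow> 'k) \<Rightarrow> 'm) \<Rightarrow>
    nat \<Rightarrow> (('g list \<Rightarrow> 'k) \<Rightarrow> 'm) \<Rightarrow> ('g list \<Rightarrow> 'k) \<Rightarrow> 'm" where
  "hochschild_diff G \<alpha> scale lact ract n \<phi> =
     (THE \<psi>. \<psi> \<in> cochains G scale (n + 1) \<and>
        (\<forall>as. length as = n + 1 \<and> set as \<subseteq> carrier (twisted_group_algebra G \<alpha>) \<longrightarrow>
           \<psi> (pure_tensor as) =
             hochschild_diff_formula (twisted_group_algebra G \<alpha>) scale lact ract n \<phi> as))"


context twisted_bimodule
begin

lemma multilinear_add:
  assumes "multilinear_on A scale n F" "multilinear_on A scale n F'"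
  shows "multilinear_on A scale n (\<lambda>as. F as + F' as)"
  by (rule multilinear_onI)
    (simp_all add: multilinear_onD[OF assms(1)] multilinear_onD[OF assms(2)] scale_right_distrib add_ac)

lemma multilinear_scale:
  assumes "multilinear_on A scale n F"
  shows "multilinear_on A scale n (\<lambda>as. scale r (F as))"
  by (rule multilinear_onI) (simp_all add: multilinear_onD[OF assms] scale_right_distrib mult.commute)

lemma multilinear_sum:
  assumes "\<And>i. i \<in> I \<Longrightarrow> multilinear_on A scale n (F i)"
  shows "multilinear_on A scale n (\<lambda>as. \<Sum>i\<in>I. F i as)"
  by (rule multilinear_onI) (simp_all add: multilinear_onD[OF assms] sum.distrib scale_sum_right)

lemma multilinear_hd:
  assumes "multilinear_on A scale n F"
  shows "multilinear_on A scale (n + 1) (\<lambda>as. lact (hd as) (F (tl as)))"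
proof (rule multilinear_onI)
  fix us vs :: "('g \<Rightarrow> 'k) list" and a
  assume H: "length us + length vs + 1 = n + 1" "set us \<subseteq> carrier A" "set vs \<subseteq> carrier A" "a \<in> carrier A"
  show "lact (hd (us @ (a \<oplus>\<^bsub>A\<^esub> b) # vs)) (F (tl (us @ (a \<oplus>\<^bsub>A\<^esub> b) # vs))) =
     lact (hd (us @ a # vs)) (F (tl (us @ a # vs))) + lact (hd (us @ b # vs)) (F (tl (us @ b # vs)))"
    if "b \<in> carrier A" for b
    using H that by (cases us) (simp_all add: lact_add_left lact_add_right multilinear_onD[OF assms])
  show "lact (hd (us @ (c \<odot>\<^bsub>A\<^esub> a) # vs)) (F (tl (us @ (c \<odot>\<^bsub>A\<^esub> a) # vs))) =
     scale c (lact (hd (us @ a # vs)) (F (tl (us @ a # vs))))" for c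
    using H by (cases us) (simp_all add: lact_scale_left lact_scale_right multilinear_onD[OF assms])
qed

lemma multilinear_last:
  assumes "multilinear_on A scale n F"
  shows "multilinear_on A scale (n + 1) (\<lambda>as. ract (F (butlast as)) (last as))"
proof (rule multilinear_onI)
  fix us vs :: "('g \<Rightarrow> 'k) list" and a
  assume H: "length us + length vs + 1 = n + 1" "set us \<subseteq> carrier A" "set vs \<subseteq> carrier A" "a \<in> carrier A"
  show "ract (F (butlast (us @ (a \<oplus>\<^bsub>A\<^esub> b) # vs))) (last (us @ (a \<oplus>\<^bsub>A\<^esub> b) # vs)) =
     ract (F (butlast (us @ a # vs))) (last (us @ a # vs)) + ract (F (butlast (us @ b # vs))) (last (us @ b # vs))"
    if "b \<in> carrier A" for b
    using H that
    by (cases vs rule: rev_cases)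
      (simp_all add: ract_add_left ract_add_right multilinear_onD[OF assms] butlast_append)
  show "ract (F (butlast (us @ (c \<odot>\<^bsub>A\<^esub> a) # vs))) (last (us @ (c \<odot>\<^bsub>A\<^esub> a) # vs)) =
     scale c (ract (F (butlast (us @ a # vs))) (last (us @ a # vs)))" for c
    using H
    by (cases vs rule: rev_cases)
      (simp_all add: ract_scale_left ract_scale_right multilinear_onD[OF assms] butlast_append)
qed

lemma merge_cases:
  fixes us vs :: "('g \<Rightarrow> 'k) list"
  assumes "j \<in> {1..n}" and H: "length us + length vs = n" "set us \<subseteq> carrier A" "set vs \<subseteq> carrier A"
  obtains us' vs' f where
    "\<And>a. take (j - 1) (us @ a # vs) @ ((us @ a # vs) ! (j - 1) \<otimes>\<^bsub>A\<^esub> (us @ a # vs) ! j) # drop (j + 1) (us @ a # vs)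
       = us' @ f a # vs'"
    "length us' + length vs' + 1 = n" "set us' \<subseteq> carrier A" "set vs' \<subseteq> carrier A"
    "\<And>a. a \<in> carrier A \<Longrightarrow> f a \<in> carrier A"
    "\<And>a b. f (a \<oplus>\<^bsub>A\<^esub> b) = f a \<oplus>\<^bsub>A\<^esub> f b" "\<And>c a. f (c \<odot>\<^bsub>A\<^esub> a) = c \<odot>\<^bsub>A\<^esub> f a"
proof -
  obtain i where j: "j = Suc i" and i: "i < n" using assms(1) by (cases j) auto
  consider "length us < i" | "length us = i" | "length us = Suc i" | "length us > Suc i" by linarith
  thus thesis
  proof cases
    case 1
    then obtain d where d: "i = Suc (length us + d)" by (metis less_iff_Suc_add)
    show ?thesis
      by (rule that[of us "\<lambda>a. a" "take d vs @ (vs ! d \<otimes>\<^bsub>A\<^esub> vs ! Suc d) # drop (Suc (Suc d)) vs"])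
        (use H i d j in \<open>auto simp: nth_append mult_closed_A numeral_3_eq_3 dest: in_set_takeD in_set_dropD\<close>)
  next
    case 2
    then obtain y ys where y: "vs = y # ys" using H i by (cases vs) auto
    show ?thesis
      by (rule that[of us "\<lambda>a. a \<otimes>\<^bsub>A\<^esub> y" ys])
        (use H i j y 2 in \<open>auto simp: nth_append mult_closed_A mult_add_A mult_smult_A\<close>)
  next
    case 3
    then obtain x xs where x: "us = xs @ [x]" by (cases us rule: rev_cases) auto
    show ?thesis
      by (rule that[of xs "\<lambda>a. x \<otimes>\<^bsub>A\<^esub> a" vs])
        (use H i j x 3 in \<open>auto simp: nth_append mult_closed_A mult_add_A mult_smult_A\<close>)
  next
    case 4
    show ?thesis
      by (rule that[of "take i us @ (us ! i \<otimes>\<^bsub>A\<^esub> us ! Suc i) # drop (Suc (Suc i)) us" "\<lambda>a. a" vs])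
        (use H i j 4 in \<open>auto simp: nth_append mult_closed_A dest: in_set_takeD in_set_dropD\<close>)
  qed
qed

lemma multilinear_merge:
  assumes F: "multilinear_on A scale n F" and j: "j \<in> {1..n}"
  shows "multilinear_on A scale (n + 1)
    (\<lambda>as. F (take (j - 1) as @ (as ! (j - 1) \<otimes>\<^bsub>A\<^esub> as ! j) # drop (j + 1) as))"
proof (rule multilinear_onI)
  fix us vs :: "('g \<Rightarrow> 'k) list" and a
  assume H: "length us + length vs + 1 = n + 1" "set us \<subseteq> carrier A" "set vs \<subseteq> carrier A" "a \<in> carrier A"
  let ?m = "\<lambda>as. take (j - 1) as @ (as ! (j - 1) \<otimes>\<^bsub>A\<^esub> as ! j) # drop (j + 1) as"
  from H have "length us + length vs = n" by simp
  then obtain us' vs' f where f: "\<And>a. ?m (us @ a # vs) = us' @ f a # vs'"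
    "length us' + length vs' + 1 = n" "set us' \<subseteq> carrier A" "set vs' \<subseteq> carrier A"
    "\<And>a. a \<in> carrier A \<Longrightarrow> f a \<in> carrier A"
    "\<And>a b. f (a \<oplus>\<^bsub>A\<^esub> b) = f a \<oplus>\<^bsub>A\<^esub> f b" "\<And>c a. f (c \<odot>\<^bsub>A\<^esub> a) = c \<odot>\<^bsub>A\<^esub> f a"
    by (rule merge_cases[OF j _ H(2,3)]) blast
  show "F (?m (us @ (a \<oplus>\<^bsub>A\<^esub> b) # vs)) = F (?m (us @ a # vs)) + F (?m (us @ b # vs))" if "b \<in> carrier A" for b
    unfolding f(1) f(6) using f H that by (intro multilinear_onD[OF F]) auto
  show "F (?m (us @ (c \<odot>\<^bsub>A\<^esub> a) # vs)) = scale c (F (?m (us @ a # vs)))" for c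
    unfolding f(1) f(7) using f H by (intro multilinear_onD[OF F]) auto
qed

theorem hochschild_diff0:
  shows "hochschild_diff0 G \<alpha> scale lact ract m \<in> cochains G scale 1"
    and "a \<in> carrier A \<Longrightarrow> hochschild_diff0 G \<alpha> scale lact ract m (pure_tensor [a]) = lact a m - ract m a"
proof -
  let ?P = "\<lambda>\<psi>. \<psi> \<in> cochains G scale 1 \<and> (\<forall>a\<in>carrier A. \<psi> (pure_tensor [a]) = lact a m - ract m a)"
  have "multilinear_on A scale 1 (\<lambda>as. lact (hd as) m - ract m (hd as))"
    by (rule multilinear_onI)
      (auto simp: lact_add_left ract_add_right lact_scale_left ract_scale_right scale_right_diff_distrib)
  from tensor_power_universal[OF this]
  have "\<exists>!\<psi>. \<psi> \<in> cochains G scale 1 \<and> (\<forall>as. length as = 1 \<and> set as \<subseteq> carrier A \<longrightarrow>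
      \<psi> (pure_tensor as) = lact (hd as) m - ract m (hd as))" .
  moreover have "(\<forall>as. length as = 1 \<and> set as \<subseteq> carrier A \<longrightarrow>
      \<psi> (pure_tensor as) = lact (hd as) m - ract m (hd as)) \<longleftrightarrow>
    (\<forall>a\<in>carrier A. \<psi> (pure_tensor [a]) = lact a m - ract m a)" (is "?L \<longleftrightarrow> ?R") for \<psi>
  proof
    assume L: ?L
    show ?R
    proof
      fix a assume "a \<in> carrier A"
      thus "\<psi> (pure_tensor [a]) = lact a m - ract m a" using L[rule_format, of "[a]"] by simp
    qed
  next
    assume R: ?R
    show ?L
    proof (intro allI impI)
      fix as :: "('g \<Rightarrow> 'k) list" assume as: "length as = 1 \<and> set as \<subseteq> carrier A"
      then obtain a where "as = [a]" by (cases as) auto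
      thus "\<psi> (pure_tensor as) = lact (hd as) m - ract m (hd as)" using R as by simp
    qed
  qed
  ultimately have "\<exists>!\<psi>. ?P \<psi>" by (simp only:)
  from theI'[OF this] show "hochschild_diff0 G \<alpha> scale lact ract m \<in> cochains G scale 1"
    and "a \<in> carrier A \<Longrightarrow> hochschild_diff0 G \<alpha> scale lact ract m (pure_tensor [a]) = lact a m - ract m a"
    unfolding hochschild_diff0_def by auto
qed

theorem hochschild_diff:
  assumes "\<phi> \<in> cochains G scale n"
  shows "hochschild_diff G \<alpha> scale lact ract n \<phi> \<in> cochains G scale (n + 1)"
    and "length as = n + 1 \<Longrightarrow> set as \<subseteq> carrier A \<Longrightarrow>
      hochschild_diff G \<alpha> scale lact ract n \<phi> (pure_tensor as) =
        hochschild_diff_formula A scale lact ract n \<phi> as"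
proof -
  have "multilinear_on A scale (n + 1) (hochschild_diff_formula A scale lact ract n \<phi>)"
    unfolding hochschild_diff_formula_def
    using multilinear_pure_tensor[OF assms]
    by (intro multilinear_add multilinear_hd multilinear_sum multilinear_scale multilinear_last multilinear_merge)
  from theI'[OF tensor_power_universal[OF this]]
  show "hochschild_diff G \<alpha> scale lact ract n \<phi> \<in> cochains G scale (n + 1)"
    and "length as = n + 1 \<Longrightarrow> set as \<subseteq> carrier A \<Longrightarrow>
      hochschild_diff G \<alpha> scale lact ract n \<phi> (pure_tensor as) =
        hochschild_diff_formula A scale lact ract n \<phi> as"
    unfolding hochschild_diff_def by auto
qed

end


section \<open>The symmetric group action\<close>

text \<open>In the formula for \<open>\<sigma>\<^sub>i\<close>, the list \<open>bs\<close> consists of the basis elements of \<open>g\<^sub>1, \<dots>, g\<^sub>n\<close>.\<close>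

definition sigma_formula ::
  "('k::field, 'g \<Rightarrow> 'k) module \<Rightarrow> (('g \<Rightarrow> 'k) \<Rightarrow> 'm::ab_group_add \<Rightarrow> 'm) \<Rightarrow> ('m \<Rightarrow> ('g \<Rightarrow> 'k) \<Rightarrow> 'm) \<Rightarrow>
    nat \<Rightarrow> nat \<Rightarrow> (('g list \<Rightarrow> 'k) \<Rightarrow> 'm) \<Rightarrow> ('g \<Rightarrow> 'k) list \<Rightarrow> 'm" where
  "sigma_formula A lact ract n i \<phi> bs =
     (if n = 1 then
        - ract (lact (bs ! 0) (\<phi> (pure_tensor [inv\<^bsub>A\<^esub> (bs ! 0)]))) (bs ! 0)
      else if i = 1 then
        - lact (bs ! 0) (\<phi> (pure_tensor ([inv\<^bsub>A\<^esub> (bs ! 0), bs ! 0 \<otimes>\<^bsub>A\<^esub> bs ! 1] @ drop 2 bs)))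
      else if i < n then
        - \<phi> (pure_tensor (take (i - 2) bs @
             [bs ! (i - 2) \<otimes>\<^bsub>A\<^esub> bs ! (i - 1), inv\<^bsub>A\<^esub> (bs ! (i - 1)), bs ! (i - 1) \<otimes>\<^bsub>A\<^esub> bs ! i] @
             drop (i + 1) bs))
      else
        - ract (\<phi> (pure_tensor (take (n - 2) bs @
             [bs ! (n - 2) \<otimes>\<^bsub>A\<^esub> bs ! (n - 1), inv\<^bsub>A\<^esub> (bs ! (n - 1))]))) (bs ! (n - 1)))"

definition sigma ::
  "('g, 'z) monoid_scheme \<Rightarrow> ('g \<Rightarrow> 'g \<Rightarrow> 'k::field) \<Rightarrow> ('k \<Rightarrow> 'm::ab_group_add \<Rightarrow> 'm) \<Rightarrow>
    (('g \<Rightarrow> 'k) \<Rightarrow> 'm \<Rightarrow> 'm) \<Rightarrow> ('m \<Rightarrow> ('g \<Rightarrow> 'k) \<Rightarrow> 'm) \<Rightarrow>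
    nat \<Rightarrow> nat \<Rightarrow> (('g list \<Rightarrow> 'k) \<Rightarrow> 'm) \<Rightarrow> ('g list \<Rightarrow> 'k) \<Rightarrow> 'm" where
  "sigma G \<alpha> scale lact ract n i \<phi> =
     linear_extension G scale n
       (\<lambda>gs. sigma_formula (twisted_group_algebra G \<alpha>) lact ract n i \<phi> (map basis_elem gs))"

text \<open>A \<open>k\<close>-linear action of \<open>\<Sigma>\<^bsub>n+1\<^esub>\<close> on the \<open>n\<close>-cochains in which \<open>(i, i+1)\<close> acts as \<open>\<sigma>\<^sub>i\<close>.\<close>

definition is_sigma_action ::
  "('g, 'z) monoid_scheme \<Rightarrow> ('g \<Rightarrow> 'g \<Rightarrow> 'k::field) \<Rightarrow> ('k \<Rightarrow> 'm::ab_group_add \<Rightarrow> 'm) \<Rightarrow>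
    (('g \<Rightarrow> 'k) \<Rightarrow> 'm \<Rightarrow> 'm) \<Rightarrow> ('m \<Rightarrow> ('g \<Rightarrow> 'k) \<Rightarrow> 'm) \<Rightarrow> nat \<Rightarrow>
    ((nat \<Rightarrow> nat) \<Rightarrow> (('g list \<Rightarrow> 'k) \<Rightarrow> 'm) \<Rightarrow> ('g list \<Rightarrow> 'k) \<Rightarrow> 'm) \<Rightarrow> bool" where
  "is_sigma_action G \<alpha> scale lact ract n \<rho> \<longleftrightarrow>
     group_action (sym_group (n + 1)) (cochains G scale n) \<rho> \<and>
     (\<forall>p\<in>carrier (sym_group (n + 1)). \<forall>\<phi>\<in>cochains G scale n.
        (\<forall>\<psi>\<in>cochains G scale n.
           \<rho> p (\<lambda>t\<in>tensor_power G n. \<phi> t + \<psi> t) = (\<lambda>t\<in>tensor_power G n. \<rho> p \<phi> t + \<rho> p \<psi> t)) \<and>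
        (\<forall>c. \<rho> p (\<lambda>t\<in>tensor_power G n. scale c (\<phi> t)) = (\<lambda>t\<in>tensor_power G n. scale c (\<rho> p \<phi> t)))) \<and>
     (\<forall>i\<in>{1..n}. \<forall>\<phi>\<in>cochains G scale n. \<rho> (transpose i (i + 1)) \<phi> = sigma G \<alpha> scale lact ract n i \<phi>)"

definition fixed_points :: "('p, 'z) monoid_scheme \<Rightarrow> 'c set \<Rightarrow> ('p \<Rightarrow> 'c \<Rightarrow> 'c) \<Rightarrow> 'c set" where
  "fixed_points S E \<rho> = {x \<in> E. \<forall>p\<in>carrier S. \<rho> p x = x}"

end

theory Submission
  imports Defs
begin

text \<open>
  Homogeneous coordinates turn the formulas into the familiar ones. For a cochain \<open>\<phi>\<close> and units
  \<open>u\<^sub>1, \<dots>, u\<^sub>n\<^sub>+\<^sub>1\<close> of the algebra put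
  \<open>F\<^sub>\<phi>(u) = u\<^sub>1 \<cdot> \<phi>(u\<^sub>1\<^sup>-\<^sup>1u\<^sub>2 \<otimes> \<dots> \<otimes> u\<^sub>n\<^sup>-\<^sup>1u\<^sub>n\<^sub>+\<^sub>1) \<cdot> u\<^sub>n\<^sub>+\<^sub>1\<^sup>-\<^sup>1\<close>.
  Exchanging \<open>u\<^sub>i\<close> and \<open>u\<^sub>i\<^sub>+\<^sub>1\<close> changes only the ratios that involve one of them, and in the way
  prescribed by \<open>\<sigma>\<^sub>i\<close>: the function of \<open>\<sigma>\<^sub>i\<phi>\<close> is \<open>u \<mapsto> -F\<^sub>\<phi>(u \<circ> (i i+1))\<close> (\<open>homogenize_sigma_formula\<close>).
  Likewise merging two neighbouring arguments of \<open>\<phi>\<close> deletes a coordinate, so that the Hochschild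
  differential becomes the alternating sum over the deletions (\<open>homogenize_hochschild_diff\<close>).

  Multiplying the coordinates by nonzero scalars does not change \<open>F\<^sub>\<phi>\<close>, since the scalars telescope
  (\<open>homogenize_proportional\<close>). Evaluated at basis elements, \<open>F\<^sub>\<phi>\<close> therefore descends to a function
  on \<open>G\<^sup>n\<^sup>+\<^sup>1\<close> in which the cocycle is no longer visible: it is equivariant for left translation, where \<open>g\<close>
  acts on \<open>M\<close> by conjugation with its basis element. Every equivariant function arises from exactly one
  cochain (\<open>group_homogenize_inj\<close>, \<open>group_homogenize_dehomogenize\<close>), because a point of \<open>G\<^sup>n\<^sup>+\<^sup>1\<close> is
  a translate of the sequence of left products \<open>1, g\<^sub>1, g\<^sub>1g\<^sub>2, \<dots>\<close>.

  On equivariant functions, permuting the coordinates and multiplying by the sign is visibly an action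
  of \<open>\<Sigma>\<^sub>n\<^sub>+\<^sub>1\<close>, and adjacent transpositions act as the \<open>\<sigma>\<^sub>i\<close>. As these generate \<open>\<Sigma>\<^sub>n\<^sub>+\<^sub>1\<close>, it is the
  only such action, and no relations between the \<open>\<sigma>\<^sub>i\<close> have to be checked. An invariant cochain is one
  whose function changes sign under adjacent transpositions (\<open>fixed_points_iff_alternating\<close>), and the
  alternating sum of deletions preserves this property (\<open>alternating_coboundary\<close>).
\<close>

section \<open>Adjacent transpositions and deletion of coordinates\<close>

lemma permutes_adjacent_induct [consumes 1, case_names id adjacent]:
  assumes "p permutes {1..Suc n}" and "P id"
    and step: "\<And>i p. i \<in> {1..n} \<Longrightarrow> p permutes {1..Suc n} \<Longrightarrow> P p \<Longrightarrow> P (transpose i (Suc i) \<circ> p)"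
  shows "P p"
proof -
  have word: "P (apply_adj_transps is \<circ> q) \<and> apply_adj_transps is \<circ> q permutes {1..Suc n}"
    if "set is \<subseteq> {1..n}" "q permutes {1..Suc n}" "P q" for "is" q
    using that
  proof (induction "is")
    case (Cons i "is")
    have i: "i \<in> {1..n}" and IH: "P (apply_adj_transps is \<circ> q)" "apply_adj_transps is \<circ> q permutes {1..Suc n}"
      using Cons by (auto simp: o_def)
    have "transpose i (Suc i) permutes {1..Suc n}"
      using i by (intro permutes_swap_id) auto
    from step[OF i IH(2,1)] permutes_compose[OF IH(2) this] show ?case
      by (simp add: o_def)
  qed auto
  have ordered: "P (transpose a b \<circ> q)"
    if "a \<in> {1..Suc n}" "b \<in> {1..Suc n}" "a < b" "q permutes {1..Suc n}" "P q" for a b q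
    using word[of "adj_transp_seq a b" q] that
    by (simp add: adj_transp_seq_correct set_adj_transp_seq subset_iff)
  show ?thesis
    using assms(1) finite_atLeastAtMost
  proof (induction rule: permutes_induct)
    case (swap a b q)
    thus ?case
      using ordered[of a b q] ordered[of b a q]
      by (cases a b rule: linorder_cases) (auto simp: transpose_commute o_def)
  qed (rule \<open>P id\<close>)
qed

text \<open>
  Composition with \<open>skip j\<close> deletes the \<open>j\<close>-th coordinate of a sequence.
\<close>

definition skip :: "nat \<Rightarrow> nat \<Rightarrow> nat" where
  "skip j i = (if i < j then i else Suc i)"

lemma transpose_comp_skip:
  "j < i \<Longrightarrow> transpose i (Suc i) \<circ> skip j = skip j \<circ> transpose (i - 1) i"
  "transpose i (Suc i) \<circ> skip i = skip (Suc i)"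
  "transpose i (Suc i) \<circ> skip (Suc i) = skip i"
  "Suc i < j \<Longrightarrow> transpose i (Suc i) \<circ> skip j = skip j \<circ> transpose i (Suc i)"
  by (auto simp: skip_def transpose_def fun_eq_iff)

text \<open>
  Apply \<open>(i i+1)\<close> to the coordinates and then delete the \<open>j\<close>-th one. For \<open>j \<notin> {i, i+1}\<close> the two entries
  are still adjacent, so \<open>H\<close> changes its sign. For \<open>j \<in> {i, i+1}\<close> the result is the other one of these two
  deletions, and the two occur in the sum with opposite signs. Thus the summand of \<open>j\<close> becomes the
  negative of the summand of the transposed index, and reindexing the sum gives the claim.
\<close>

lemma alternating_coboundary:
  fixes H D :: "(nat \<Rightarrow> 'g) \<Rightarrow> 'm::ab_group_add" and s :: "nat \<Rightarrow> 'm \<Rightarrow> 'm"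
  assumes D: "\<And>x. range x \<subseteq> X \<Longrightarrow> D x = (\<Sum>j=1..n+2. s j (H (x \<circ> skip j)))"
    and s: "\<And>j m. s (Suc j) m = - s j m" "\<And>j m. s j (- m) = - s j m"
    and H: "\<And>x i. range x \<subseteq> X \<Longrightarrow> i \<in> {1..n} \<Longrightarrow> H (x \<circ> transpose i (Suc i)) = - H x"
    and x: "range x \<subseteq> X" and i: "i \<in> {1..n+1}"
  shows "D (x \<circ> transpose i (Suc i)) = - D x"
proof -
  let ?t = "transpose i (Suc i)"
  have t: "?t permutes {1..n+2}"
    using i by (intro permutes_swap_id) auto
  have r: "range (x \<circ> f) \<subseteq> X" for f :: "nat \<Rightarrow> nat"
    using x by auto
  have *: "s j (H (x \<circ> ?t \<circ> skip j)) = - s (?t j) (H (x \<circ> skip (?t j)))" if j: "j \<in> {1..n+2}" for j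
  proof -
    consider "j < i" | "j = i" | "j = Suc i" | "Suc i < j" by linarith
    thus ?thesis
    proof cases
      case 1
      hence "H (x \<circ> skip j \<circ> transpose (i - 1) (Suc (i - 1))) = - H (x \<circ> skip j)"
        using i j by (intro H r) auto
      thus ?thesis using 1 by (simp add: comp_assoc transpose_comp_skip s)
    next
      case 4
      hence "H (x \<circ> skip j \<circ> ?t) = - H (x \<circ> skip j)"
        using i j by (intro H r) auto
      thus ?thesis using 4 by (simp add: comp_assoc transpose_comp_skip s)
    qed (simp_all add: comp_assoc transpose_comp_skip s)
  qed
  have "D (x \<circ> ?t) = (\<Sum>j=1..n+2. - s (?t j) (H (x \<circ> skip (?t j))))"
    unfolding D[OF r] by (intro sum.cong refl *)
  also have "\<dots> = (\<Sum>j=1..n+2. - s j (H (x \<circ> skip j)))"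
    using sum.permute[OF t, of "\<lambda>j. - s j (H (x \<circ> skip j))"] by (simp add: o_def)
  finally show ?thesis by (simp add: D[OF x] sum_negf)
qed

section \<open>Left products and units in monoids\<close>

text \<open>
  The sequence \<open>1, a\<^sub>1, a\<^sub>1a\<^sub>2, \<dots>\<close>, starting at index \<open>1\<close>. Indices outside of the list also give
  a product of entries, so that all values are units if the entries are.
\<close>

definition left_product :: "('a, 'b) monoid_scheme \<Rightarrow> 'a list \<Rightarrow> nat \<Rightarrow> 'a" where
  "left_product M as i = foldl (mult M) \<one>\<^bsub>M\<^esub> (take (i - 1) as)"

lemma left_product_1 [simp]: "left_product M as 1 = \<one>\<^bsub>M\<^esub>" "left_product M as (Suc 0) = \<one>\<^bsub>M\<^esub>"
  by (simp_all add: left_product_def)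

lemma left_product_Suc:
  assumes "i \<in> {1..length as}"
  shows "left_product M as (Suc i) = left_product M as i \<otimes>\<^bsub>M\<^esub> as ! (i - 1)"
proof -
  obtain j where "i = Suc j" using assms by (cases i) auto
  thus ?thesis using assms by (simp add: left_product_def take_Suc_conv_app_nth)
qed

lemma (in Group.monoid) left_product_Units:
  assumes "set as \<subseteq> Units G"
  shows "left_product G as i \<in> Units G"
proof -
  have "foldl (\<otimes>) u bs \<in> Units G" if "u \<in> Units G" "set bs \<subseteq> Units G" for u bs
    using that by (induction bs arbitrary: u) auto
  thus ?thesis using assms set_take_subset[of "i - 1" as] by (simp add: left_product_def subset_trans)
qed

lemma (in Group.monoid) inv_mult_inv_Units:
  assumes "a \<in> Units G" "b \<in> Units G"
  shows "inv (inv a \<otimes> b) = inv b \<otimes> a"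
proof (rule inv_unique'[symmetric])
  have 1: "a \<in> carrier G" "b \<in> carrier G" using assms by auto
  have "inv a \<otimes> b \<otimes> (inv b \<otimes> a) = inv a \<otimes> ((b \<otimes> inv b) \<otimes> a)"
    using assms 1 by (simp only: m_assoc Units_inv_closed m_closed)
  thus "inv a \<otimes> b \<otimes> (inv b \<otimes> a) = \<one>" using assms 1 by simp
  have "inv b \<otimes> a \<otimes> (inv a \<otimes> b) = inv b \<otimes> ((a \<otimes> inv a) \<otimes> b)"
    using assms 1 by (simp only: m_assoc Units_inv_closed m_closed)
  thus "inv b \<otimes> a \<otimes> (inv a \<otimes> b) = \<one>" using assms 1 by simp
qed (use assms in auto)

lemma (in Group.monoid) Units_cancel:
  assumes "a \<in> Units G" "b \<in> carrier G"
  shows "inv a \<otimes> (a \<otimes> b) = b" "a \<otimes> (inv a \<otimes> b) = b"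
  using assms m_assoc[of "inv a" a b] m_assoc[of a "inv a" b] by (simp_all add: Units_closed)

section \<open>Homogeneous form of a cochain\<close>

context twisted_bimodule
begin

interpretation A: ring A by (rule ring_A)

lemma lact_inv:
  assumes "a \<in> Units A"
  shows "lact (inv\<^bsub>A\<^esub> a) (lact a m) = m" "lact a (lact (inv\<^bsub>A\<^esub> a) m) = m"
  using assms by (simp_all add: lact_mult[symmetric] lact_one A.Units_closed)

lemma ract_inv:
  assumes "a \<in> Units A"
  shows "ract (ract m (inv\<^bsub>A\<^esub> a)) a = m" "ract (ract m a) (inv\<^bsub>A\<^esub> a) = m"
  using assms by (simp_all add: ract_mult[symmetric] ract_one A.Units_closed)

lemma act_minus:
  assumes "a \<in> carrier A"
  shows "lact a (- m) = - lact a m" "ract (- m) a = - ract m a"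
  using lact_scale_right[OF assms, of "-1" m] ract_scale_left[OF assms, of "-1" m] by simp_all

lemma act_sum:
  assumes "a \<in> carrier A"
  shows "lact a (\<Sum>i\<in>I. f i) = (\<Sum>i\<in>I. lact a (f i))" "ract (\<Sum>i\<in>I. f i) a = (\<Sum>i\<in>I. ract (f i) a)"
  using lact_scale_right[OF assms, of 0 0] ract_scale_left[OF assms, of 0 0]
  by (induction I rule: infinite_finite_induct) (simp_all add: lact_add_right ract_add_left assms)

text \<open>
  The coordinates \<open>u\<^sub>1, \<dots>, u\<^sub>n\<^sub>+\<^sub>1\<close> are the values of a total function \<open>u\<close> on the natural numbers, so that
  permutations and deletions of coordinates act by composition.
\<close>

definition ratios :: "(nat \<Rightarrow> 'g \<Rightarrow> 'k) \<Rightarrow> nat \<Rightarrow> ('g \<Rightarrow> 'k) list" where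
  "ratios u n = map (\<lambda>i. inv\<^bsub>A\<^esub> (u i) \<otimes>\<^bsub>A\<^esub> u (Suc i)) [1..<Suc n]"

definition homogenize :: "nat \<Rightarrow> (('g list \<Rightarrow> 'k) \<Rightarrow> 'm) \<Rightarrow> (nat \<Rightarrow> 'g \<Rightarrow> 'k) \<Rightarrow> 'm" where
  "homogenize n \<phi> u = lact (u 1) (ract (\<phi> (pure_tensor (ratios u n))) (inv\<^bsub>A\<^esub> (u (Suc n))))"

lemma length_ratios [simp]: "length (ratios u n) = n"
  by (simp add: ratios_def)

lemma nth_ratios [simp]: "i < n \<Longrightarrow> ratios u n ! i = inv\<^bsub>A\<^esub> (u (Suc i)) \<otimes>\<^bsub>A\<^esub> u (Suc (Suc i))"
  by (simp add: ratios_def del: upt_Suc)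

lemma set_ratios:
  assumes "range u \<subseteq> Units A"
  shows "set (ratios u n) \<subseteq> carrier A"
  using assms by (auto simp: ratios_def image_subset_iff simp del: upt_Suc intro!: A.m_closed)

lemma ratio_simps:
  assumes "a \<in> Units A" "b \<in> Units A"
  shows "inv\<^bsub>A\<^esub> (inv\<^bsub>A\<^esub> a \<otimes>\<^bsub>A\<^esub> b) = inv\<^bsub>A\<^esub> b \<otimes>\<^bsub>A\<^esub> a"
    and "c \<in> Units A \<Longrightarrow> (inv\<^bsub>A\<^esub> a \<otimes>\<^bsub>A\<^esub> b) \<otimes>\<^bsub>A\<^esub> (inv\<^bsub>A\<^esub> b \<otimes>\<^bsub>A\<^esub> c) = inv\<^bsub>A\<^esub> a \<otimes>\<^bsub>A\<^esub> c"
    and "lact a (lact (inv\<^bsub>A\<^esub> a \<otimes>\<^bsub>A\<^esub> b) m) = lact b m"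
    and "ract (ract m (inv\<^bsub>A\<^esub> a \<otimes>\<^bsub>A\<^esub> b)) (inv\<^bsub>A\<^esub> b) = ract m (inv\<^bsub>A\<^esub> a)"
  using assms
  by (simp_all add: A.m_assoc A.Units_cancel A.inv_mult_inv_Units A.Units_closed lact_mult ract_mult
      lact_inv ract_inv)

text \<open>
  For the transposed sequence, the ratios at positions \<open>i-1\<close>, \<open>i\<close>, \<open>i+1\<close> are
  \<open>u\<^sub>i\<^sub>-\<^sub>1\<^sup>-\<^sup>1u\<^sub>i\<^sub>+\<^sub>1 = a\<^sub>i\<^sub>-\<^sub>1a\<^sub>i\<close>, \<open>u\<^sub>i\<^sub>+\<^sub>1\<^sup>-\<^sup>1u\<^sub>i = a\<^sub>i\<^sup>-\<^sup>1\<close> and \<open>u\<^sub>i\<^sup>-\<^sup>1u\<^sub>i\<^sub>+\<^sub>2 = a\<^sub>ia\<^sub>i\<^sub>+\<^sub>1\<close>, where \<open>a\<^sub>j = u\<^sub>j\<^sup>-\<^sup>1u\<^sub>j\<^sub>+\<^sub>1\<close>.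
  If \<open>i\<close> is \<open>1\<close> or \<open>n\<close>, the missing ratio is replaced by the action of \<open>a\<^sub>i\<close> on the outside, which moves the
  outer factor from \<open>u\<^sub>1\<close> to \<open>u\<^sub>2\<close>, or from \<open>u\<^sub>n\<^sub>+\<^sub>1\<^sup>-\<^sup>1\<close> to \<open>u\<^sub>n\<^sup>-\<^sup>1\<close>.
\<close>

theorem homogenize_sigma_formula:
  assumes u: "range u \<subseteq> Units A" and i: "i \<in> {1..n}"
  shows "lact (u 1) (ract (sigma_formula A lact ract n i \<phi> (ratios u n)) (inv\<^bsub>A\<^esub> (u (Suc n)))) =
    - homogenize n \<phi> (u \<circ> transpose i (Suc i))"
proof -
  note [simp] = ratio_simps lact_ract act_minus
  have uU [simp]: "u j \<in> Units A" and uA [simp]: "u j \<in> carrier A" for j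
    using u by (auto simp: image_subset_iff)
  consider "n = 1" | "i = 1" "n > 1" | "1 < i" "i < n" | "i = n" "n > 1" using i by force
  thus ?thesis
  proof cases
    case 1
    have "ratios (u \<circ> transpose i (Suc i)) 1 = [inv\<^bsub>A\<^esub> (ratios u n ! 0)]"
      using 1 i by (intro nth_equalityI) auto
    thus ?thesis using 1 i
      by (simp add: sigma_formula_def homogenize_def)
  next
    case 2
    have "ratios (u \<circ> transpose i (Suc i)) n =
        [inv\<^bsub>A\<^esub> (ratios u n ! 0), ratios u n ! 0 \<otimes>\<^bsub>A\<^esub> ratios u n ! 1] @ drop 2 (ratios u n)"
    proof (rule nth_equalityI)
      fix k assume k: "k < length (ratios (u \<circ> transpose i (Suc i)) n)"
      consider "k = 0" | "k = 1" | j where "k = Suc (Suc j)"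
        by (metis One_nat_def not0_implies_Suc)
      thus "ratios (u \<circ> transpose i (Suc i)) n ! k =
          ([inv\<^bsub>A\<^esub> (ratios u n ! 0), ratios u n ! 0 \<otimes>\<^bsub>A\<^esub> ratios u n ! 1] @ drop 2 (ratios u n)) ! k"
        using 2 k by cases (auto simp: transpose_def)
    qed (use 2 in auto)
    thus ?thesis using 2
      by (simp add: sigma_formula_def homogenize_def)
  next
    case 3
    have "ratios (u \<circ> transpose i (Suc i)) n = take (i - 2) (ratios u n) @
             [ratios u n ! (i - 2) \<otimes>\<^bsub>A\<^esub> ratios u n ! (i - 1), inv\<^bsub>A\<^esub> (ratios u n ! (i - 1)),
              ratios u n ! (i - 1) \<otimes>\<^bsub>A\<^esub> ratios u n ! i] @ drop (i + 1) (ratios u n)"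
    proof (rule nth_equalityI)
      fix k assume k: "k < length (ratios (u \<circ> transpose i (Suc i)) n)"
      obtain j where "i = Suc (Suc j)" using 3 by (metis less_iff_Suc_add add_Suc One_nat_def)
      consider "k < j" | "k = j" | "k = Suc j" | "k = Suc (Suc j)" | l where "k = Suc (Suc (Suc (j + l)))"
        by atomize_elim presburger
      thus "ratios (u \<circ> transpose i (Suc i)) n ! k = (take (i - 2) (ratios u n) @
             [ratios u n ! (i - 2) \<otimes>\<^bsub>A\<^esub> ratios u n ! (i - 1), inv\<^bsub>A\<^esub> (ratios u n ! (i - 1)),
              ratios u n ! (i - 1) \<otimes>\<^bsub>A\<^esub> ratios u n ! i] @ drop (i + 1) (ratios u n)) ! k"
        using 3 k \<open>i = Suc (Suc j)\<close> by cases (auto simp: nth_append nth_Cons' transpose_def)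
    qed (use 3 in auto)
    thus ?thesis using 3
      by (simp add: sigma_formula_def homogenize_def)
  next
    case 4
    have "ratios (u \<circ> transpose i (Suc i)) n = take (n - 2) (ratios u n) @
             [ratios u n ! (n - 2) \<otimes>\<^bsub>A\<^esub> ratios u n ! (n - 1), inv\<^bsub>A\<^esub> (ratios u n ! (n - 1))]"
    proof (rule nth_equalityI)
      fix k assume k: "k < length (ratios (u \<circ> transpose i (Suc i)) n)"
      obtain j where "n = Suc (Suc j)" using 4 by (metis less_iff_Suc_add add_Suc One_nat_def)
      consider "k < j" | "k = j" | "k = Suc j" | "k > Suc j" by linarith
      thus "ratios (u \<circ> transpose i (Suc i)) n ! k = (take (n - 2) (ratios u n) @
             [ratios u n ! (n - 2) \<otimes>\<^bsub>A\<^esub> ratios u n ! (n - 1), inv\<^bsub>A\<^esub> (ratios u n ! (n - 1))]) ! k"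
        using 4 k \<open>n = Suc (Suc j)\<close> by cases (auto simp: nth_append nth_Cons' transpose_def)
    qed (use 4 in auto)
    moreover obtain j where "n = Suc (Suc j)" using 4 by (metis less_iff_Suc_add add_Suc One_nat_def)
    ultimately show ?thesis using 4
      by (simp add: sigma_formula_def homogenize_def)
  qed
qed

text \<open>
  Deleting the inner coordinate \<open>u\<^sub>j\<^sub>+\<^sub>1\<close> multiplies the two ratios next to it; deleting \<open>u\<^sub>1\<close> or
  \<open>u\<^sub>n\<^sub>+\<^sub>2\<close> drops an outer ratio, which the outer action of the differential compensates.
\<close>

theorem homogenize_hochschild_diff:
  assumes u: "range u \<subseteq> Units A" and \<phi>: "\<phi> \<in> cochains G scale n"
  shows "homogenize (n + 1) (hochschild_diff G \<alpha> scale lact ract n \<phi>) u =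
    (\<Sum>j=1..n+2. scale ((-1) ^ (j + 1)) (homogenize n \<phi> (u \<circ> skip j)))"
proof -
  note [simp] = ratio_simps
  have uU [simp]: "u j \<in> Units A" and uA [simp]: "u j \<in> carrier A" for j
    using u by (auto simp: image_subset_iff)
  let ?r = "ratios u (n + 1)" and ?v = "inv\<^bsub>A\<^esub> (u (n + 2))"
  have "ratios (u \<circ> skip 1) n = tl ?r"
    by (intro nth_equalityI) (auto simp: nth_tl skip_def)
  moreover have "hd ?r = ?r ! 0" by (intro hd_conv_nth) (simp flip: length_greater_0_conv)
  ultimately have 1: "lact (u 1) (ract (lact (hd ?r) (\<phi> (pure_tensor (tl ?r)))) ?v) =
      homogenize n \<phi> (u \<circ> skip 1)"
    by (simp add: homogenize_def skip_def lact_ract)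
  have "ratios (u \<circ> skip (n + 2)) n = butlast ?r"
    by (intro nth_equalityI) (auto simp: nth_butlast skip_def)
  moreover have "last ?r = ?r ! n" by (subst last_conv_nth) (simp_all flip: length_greater_0_conv)
  ultimately have 2: "lact (u 1) (ract (ract (\<phi> (pure_tensor (butlast ?r))) (last ?r)) ?v) =
      homogenize n \<phi> (u \<circ> skip (n + 2))"
    by (simp add: homogenize_def skip_def)
  have 3: "lact (u 1) (ract (\<phi> (pure_tensor (take (j - 1) ?r @ (?r ! (j - 1) \<otimes>\<^bsub>A\<^esub> ?r ! j) # drop (j + 1) ?r))) ?v) =
      homogenize n \<phi> (u \<circ> skip (j + 1))" if j: "j \<in> {1..n}" for j
  proof -
    have "ratios (u \<circ> skip (j + 1)) n = take (j - 1) ?r @ (?r ! (j - 1) \<otimes>\<^bsub>A\<^esub> ?r ! j) # drop (j + 1) ?r"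
    proof (rule nth_equalityI)
      fix k assume k: "k < length (ratios (u \<circ> skip (j + 1)) n)"
      obtain i where "j = Suc i" using j by (cases j) auto
      consider "k < i" | "k = i" | "k > i" by linarith
      thus "ratios (u \<circ> skip (j + 1)) n ! k =
          (take (j - 1) ?r @ (?r ! (j - 1) \<otimes>\<^bsub>A\<^esub> ?r ! j) # drop (j + 1) ?r) ! k"
        using j k \<open>j = Suc i\<close> by cases (auto simp: nth_append nth_Cons' skip_def)
    qed (use j in auto)
    thus ?thesis using j by (simp add: homogenize_def skip_def)
  qed
  have "homogenize (n + 1) (hochschild_diff G \<alpha> scale lact ract n \<phi>) u =
      lact (u 1) (ract (hochschild_diff_formula A scale lact ract n \<phi> ?r) ?v)"
    using hochschild_diff(2)[OF \<phi>, of ?r] set_ratios[OF u] by (simp add: homogenize_def)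
  also have "\<dots> = homogenize n \<phi> (u \<circ> skip 1)
      + (\<Sum>j=1..n. scale ((-1) ^ j) (homogenize n \<phi> (u \<circ> skip (j + 1))))
      + scale ((-1) ^ (n + 1)) (homogenize n \<phi> (u \<circ> skip (n + 2)))"
    unfolding hochschild_diff_formula_def
    by (simp add: lact_add_right ract_add_left act_sum lact_scale_right ract_scale_left
        flip: 1 2 3 del: One_nat_def add_2_eq_Suc' power_Suc)
  also have "(\<Sum>j=1..n. scale ((-1) ^ j) (homogenize n \<phi> (u \<circ> skip (j + 1)))) =
      (\<Sum>j=2..n+1. scale ((-1) ^ (j + 1)) (homogenize n \<phi> (u \<circ> skip j)))"
    using sum.shift_bounds_cl_Suc_ivl[of "\<lambda>j. scale ((-1) ^ (j + 1)) (homogenize n \<phi> (u \<circ> skip j))" 1 n]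
    by (simp add: numeral_2_eq_2)
  also have "homogenize n \<phi> (u \<circ> skip 1) + \<dots> + scale ((-1) ^ (n + 1)) (homogenize n \<phi> (u \<circ> skip (n + 2))) =
    (\<Sum>j=1..n+2. scale ((-1) ^ (j + 1)) (homogenize n \<phi> (u \<circ> skip j)))"
    by (simp add: sum.atLeast_Suc_atMost numeral_2_eq_2)
  finally show ?thesis .
qed


section \<open>Cochains as equivariant functions on the group\<close>

lemma smult_smult_A: "c \<odot>\<^bsub>A\<^esub> (d \<odot>\<^bsub>A\<^esub> a) = (c * d) \<odot>\<^bsub>A\<^esub> a"
  and smult_one_A: "1 \<odot>\<^bsub>A\<^esub> a = a"
  by (simp_all add: smult_A mult.assoc)

lemma smult_Units:
  assumes "a \<in> Units A" "c \<noteq> 0"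
  shows "c \<odot>\<^bsub>A\<^esub> a \<in> Units A" "inv\<^bsub>A\<^esub> (c \<odot>\<^bsub>A\<^esub> a) = inverse c \<odot>\<^bsub>A\<^esub> inv\<^bsub>A\<^esub> a"
proof -
  have a: "a \<in> carrier A" "inv\<^bsub>A\<^esub> a \<in> carrier A" using assms by auto
  have 1: "(c \<odot>\<^bsub>A\<^esub> a) \<otimes>\<^bsub>A\<^esub> (inverse c \<odot>\<^bsub>A\<^esub> inv\<^bsub>A\<^esub> a) = \<one>\<^bsub>A\<^esub>" "(inverse c \<odot>\<^bsub>A\<^esub> inv\<^bsub>A\<^esub> a) \<otimes>\<^bsub>A\<^esub> (c \<odot>\<^bsub>A\<^esub> a) = \<one>\<^bsub>A\<^esub>"
    using assms by (simp_all add: mult_smult_A smult_smult_A smult_one_A)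
  show "inv\<^bsub>A\<^esub> (c \<odot>\<^bsub>A\<^esub> a) = inverse c \<odot>\<^bsub>A\<^esub> inv\<^bsub>A\<^esub> a"
    using a 1 by (intro A.inv_unique'[symmetric]) auto
  show "c \<odot>\<^bsub>A\<^esub> a \<in> Units A"
    using a 1 unfolding Units_def by (auto intro!: bexI[of _ "inverse c \<odot>\<^bsub>A\<^esub> inv\<^bsub>A\<^esub> a"])
qed

lemma pure_tensor_smult_all:
  "pure_tensor (map (\<lambda>i. d i \<odot>\<^bsub>A\<^esub> a i) is) = (\<lambda>gs. prod_list (map d is) * pure_tensor (map a is) gs)"
proof
  show "pure_tensor (map (\<lambda>i. d i \<odot>\<^bsub>A\<^esub> a i) is) gs = prod_list (map d is) * pure_tensor (map a is) gs" for gs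
  proof (induction "is" arbitrary: gs)
    case Nil thus ?case by simp
  next
    case (Cons i "is") thus ?case by (cases gs) (auto simp: smult_A)
  qed
qed

lemma prod_list_telescope:
  fixes c :: "nat \<Rightarrow> 'k"
  assumes "\<And>i. i \<in> {1..Suc n} \<Longrightarrow> c i \<noteq> 0"
  shows "prod_list (map (\<lambda>i. inverse (c i) * c (Suc i)) [1..<Suc n]) = inverse (c 1) * c (Suc n)"
  using assms by (induction n) (auto simp: field_simps)

text \<open>
  Scaling each \<open>u\<^sub>i\<close> by \<open>c\<^sub>i\<close> scales the tensor of ratios by the telescoping product \<open>c\<^sub>1\<^sup>-\<^sup>1c\<^sub>n\<^sub>+\<^sub>1\<close>, which the
  outer factors \<open>u\<^sub>1\<close> and \<open>u\<^sub>n\<^sub>+\<^sub>1\<^sup>-\<^sup>1\<close> cancel. This is why the twist disappears: products of basis elements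
  agree with basis elements of products up to a scalar.
\<close>

theorem homogenize_proportional:
  assumes \<phi>: "\<phi> \<in> cochains G scale n" and u: "range u \<subseteq> Units A"
    and v: "\<And>i. i \<in> {1..Suc n} \<Longrightarrow> \<exists>c. c \<noteq> 0 \<and> v i = c \<odot>\<^bsub>A\<^esub> u i"
  shows "homogenize n \<phi> v = homogenize n \<phi> u"
proof -
  obtain c where c: "c i \<noteq> 0" "v i = c i \<odot>\<^bsub>A\<^esub> u i" if "i \<in> {1..Suc n}" for i
    using v by metis
  have uU: "u i \<in> Units A" and uA: "u i \<in> carrier A" for i
    using u by (auto simp: image_subset_iff)
  let ?d = "\<lambda>i. inverse (c i) * c (Suc i)"
  have "ratios v n = map (\<lambda>i. ?d i \<odot>\<^bsub>A\<^esub> (inv\<^bsub>A\<^esub> (u i) \<otimes>\<^bsub>A\<^esub> u (Suc i))) [1..<Suc n]"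
    unfolding ratios_def by (intro map_cong refl) (auto simp: c smult_Units uU mult_smult_A smult_smult_A mult.commute)
  hence "pure_tensor (ratios v n) = (\<lambda>gs. (inverse (c 1) * c (Suc n)) * pure_tensor (ratios u n) gs)"
    by (simp only: pure_tensor_smult_all ratios_def prod_list_telescope[of n c, OF c(1)])
  moreover have "pure_tensor (ratios u n) \<in> tensor_power G n"
    using u by (intro pure_tensor_closed set_ratios) auto
  ultimately have "\<phi> (pure_tensor (ratios v n)) = scale (inverse (c 1) * c (Suc n)) (\<phi> (pure_tensor (ratios u n)))"
    using \<phi> by (simp add: cochains_def linear_map_on_def)
  moreover have "inverse (c (Suc n)) * (inverse (c 1) * c (Suc n)) * c 1 = 1"
    using c(1)[of 1] c(1)[of "Suc n"] by (simp add: field_simps)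
  ultimately show ?thesis
    using c[of 1] c[of "Suc n"] uU uA
    by (simp add: homogenize_def smult_Units lact_scale_left ract_scale_right lact_scale_right ract_scale_left)
qed

lemma homogenize_translate:
  assumes u: "range u \<subseteq> Units A" and w: "w \<in> Units A"
  shows "homogenize n \<phi> (\<lambda>i. w \<otimes>\<^bsub>A\<^esub> u i) = lact w (ract (homogenize n \<phi> u) (inv\<^bsub>A\<^esub> w))"
proof -
  have uU: "u i \<in> Units A" and uA: "u i \<in> carrier A" for i
    using u by (auto simp: image_subset_iff)
  have wA: "w \<in> carrier A" using w by auto
  have i: "inv\<^bsub>A\<^esub> (w \<otimes>\<^bsub>A\<^esub> u i) = inv\<^bsub>A\<^esub> (u i) \<otimes>\<^bsub>A\<^esub> inv\<^bsub>A\<^esub> w" for i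
    using A.inv_mult_inv_Units[of "inv\<^bsub>A\<^esub> w" "u i"] w uU by simp
  have "ratios (\<lambda>i. w \<otimes>\<^bsub>A\<^esub> u i) n = ratios u n"
    unfolding ratios_def i using w wA uU uA by (intro map_cong refl) (simp add: A.m_assoc A.Units_cancel)
  thus ?thesis
    using w wA uU uA by (simp add: homogenize_def i lact_mult ract_mult lact_ract)
qed

text \<open>
  Left products invert the passage to ratios; this recovers a cochain from its homogeneous form.
\<close>

lemma ratios_left_product:
  assumes as: "set as \<subseteq> Units A" "length as = n"
  shows "ratios (left_product A as) n = as"
proof (rule nth_equalityI)
  fix k assume k: "k < length (ratios (left_product A as) n)"
  hence "as ! k \<in> carrier A" using as by (auto dest!: nth_mem)
  thus "ratios (left_product A as) n ! k = as ! k"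
    using as k left_product_Suc[of "Suc k" as A] A.left_product_Units[of as] by (simp add: A.Units_cancel)
qed (use as in simp)

lemma left_product_basis:
  assumes gs: "gs \<in> tuples G n" and i: "i \<in> {1..Suc n}"
  shows "\<exists>c. c \<noteq> 0 \<and> left_product A (map basis_elem gs) i = c \<odot>\<^bsub>A\<^esub> basis_elem (left_product G gs i)"
proof -
  obtain j where "i = Suc j" using i by (cases i) auto
  have "j \<le> n \<Longrightarrow> \<exists>c. c \<noteq> 0 \<and>
      left_product A (map basis_elem gs) (Suc j) = c \<odot>\<^bsub>A\<^esub> basis_elem (left_product G gs (Suc j))"
  proof (induction j)
    case 0
    have "\<one>\<^bsub>A\<^esub> = 1 \<odot>\<^bsub>A\<^esub> basis_elem \<one>" by (simp add: twisted_group_algebra_def)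
    thus ?case by (intro exI[of _ 1]) simp
  next
    case (Suc j)
    then obtain c where c: "c \<noteq> 0"
      "left_product A (map basis_elem gs) (Suc j) = c \<odot>\<^bsub>A\<^esub> basis_elem (left_product G gs (Suc j))"
      by auto
    have len: "length gs = n" "set gs \<subseteq> carrier G" using gs by (auto simp: tuples_def)
    hence g: "gs ! j \<in> carrier G" "left_product G gs (Suc j) \<in> carrier G"
      using Suc.prems nth_mem[of j gs] left_product_Units[of gs] by (auto simp: subset_iff)
    show ?case
      using Suc.prems len g c left_product_Suc[of "Suc j" "map basis_elem gs" A] left_product_Suc[of "Suc j" gs G]
        cocycle_nonzero[OF g(2,1)]
      by (intro exI[of _ "c * \<alpha> (left_product G gs (Suc j)) (gs ! j)"])
        (simp add: mult_smult_A mult_basis_elem smult_smult_A)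
  qed
  thus ?thesis using \<open>i = Suc j\<close> i by simp
qed

definition group_homogenize :: "nat \<Rightarrow> (('g list \<Rightarrow> 'k) \<Rightarrow> 'm) \<Rightarrow> (nat \<Rightarrow> 'g) \<Rightarrow> 'm" where
  "group_homogenize n \<phi> x = homogenize n \<phi> (basis_elem \<circ> x)"

text \<open>
  Homogeneous \<open>n\<close>-cochains of \<open>G\<close> with values in \<open>M\<close>, on which \<open>g\<close> acts by conjugation with its basis element.
  As sequences are total functions, it has to be required that only the first \<open>n+1\<close> coordinates matter.
\<close>

definition equivariant :: "nat \<Rightarrow> ((nat \<Rightarrow> 'g) \<Rightarrow> 'm) \<Rightarrow> bool" where
  "equivariant n K \<longleftrightarrow>
     (\<forall>x y. range x \<subseteq> carrier G \<longrightarrow> range y \<subseteq> carrier G \<longrightarrow> (\<forall>i\<in>{1..Suc n}. x i = y i) \<longrightarrow> K x = K y) \<and>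
     (\<forall>g\<in>carrier G. \<forall>x. range x \<subseteq> carrier G \<longrightarrow>
        K (\<lambda>i. g \<otimes> x i) = lact (basis_elem g) (ract (K x) (inv\<^bsub>A\<^esub> (basis_elem g))))"

text \<open>
  The inverse of \<open>group_homogenize\<close>. The left products begin with the identity, and the last factor of the
  homogeneous form is undone by the action of the product of all basis elements, which is taken in the
  algebra and not in the group.
\<close>

definition dehomogenize :: "nat \<Rightarrow> ((nat \<Rightarrow> 'g) \<Rightarrow> 'm) \<Rightarrow> ('g list \<Rightarrow> 'k) \<Rightarrow> 'm" where
  "dehomogenize n K = linear_extension G scale n
     (\<lambda>gs. ract (K (left_product G gs)) (left_product A (map basis_elem gs) (Suc n)))"

lemma range_basis: "range x \<subseteq> carrier G \<Longrightarrow> range (basis_elem \<circ> x) \<subseteq> Units A"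
  by (auto simp: inv_basis_elem(1))

lemma range_left_product:
  assumes "gs \<in> tuples G n"
  shows "range (left_product G gs) \<subseteq> carrier G" "range (left_product A (map basis_elem gs)) \<subseteq> Units A"
proof -
  have "set gs \<subseteq> Units G" "set (map basis_elem gs) \<subseteq> Units A"
    using assms by (auto simp: tuples_def subset_iff inv_basis_elem(1))
  from left_product_Units[OF this(1)] A.left_product_Units[OF this(2)]
  show "range (left_product G gs) \<subseteq> carrier G" "range (left_product A (map basis_elem gs)) \<subseteq> Units A"
    by (auto simp del: set_map)
qed

lemma homogenize_left_product_permute:
  assumes \<phi>: "\<phi> \<in> cochains G scale n" and gs: "gs \<in> tuples G n" and p: "p permutes {1..Suc n}"
  shows "homogenize n \<phi> (left_product A (map basis_elem gs) \<circ> p) = group_homogenize n \<phi> (left_product G gs \<circ> p)"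
  unfolding group_homogenize_def
proof (rule homogenize_proportional[OF \<phi>])
  show "range (basis_elem \<circ> (left_product G gs \<circ> p)) \<subseteq> Units A"
    using range_left_product(1)[OF gs] by (intro range_basis) auto
  show "\<exists>c. c \<noteq> 0 \<and> (left_product A (map basis_elem gs) \<circ> p) i = c \<odot>\<^bsub>A\<^esub> (basis_elem \<circ> (left_product G gs \<circ> p)) i"
    if "i \<in> {1..Suc n}" for i
    using left_product_basis[OF gs, of "p i"] permutes_in_image[OF p, of i] that by simp
qed

lemma group_homogenize_left_product:
  assumes \<phi>: "\<phi> \<in> cochains G scale n" and gs: "gs \<in> tuples G n"
  shows "group_homogenize n \<phi> (left_product G gs) =
    ract (\<phi> (pure_tensor (map basis_elem gs))) (inv\<^bsub>A\<^esub> (left_product A (map basis_elem gs) (Suc n)))"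
proof -
  have "ratios (left_product A (map basis_elem gs)) n = map basis_elem gs"
    using gs by (intro ratios_left_product) (auto simp: tuples_def inv_basis_elem(1))
  with homogenize_left_product_permute[OF \<phi> gs permutes_id] show ?thesis
    by (simp add: homogenize_def lact_one)
qed

text \<open>
  By \<open>group_homogenize_left_product\<close>, the values at the sequences of left products determine the cochain on
  the basis, hence everywhere.
\<close>

lemma group_homogenize_inj:
  assumes \<phi>: "\<phi> \<in> cochains G scale n" and \<psi>: "\<psi> \<in> cochains G scale n"
    and eq: "\<And>x. range x \<subseteq> carrier G \<Longrightarrow> group_homogenize n \<phi> x = group_homogenize n \<psi> x"
  shows "\<phi> = \<psi>"
proof -
  have *: "\<phi> (basis_elem gs) = \<psi> (basis_elem gs)" if gs: "gs \<in> tuples G n" for gs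
  proof -
    let ?u = "left_product A (map basis_elem gs) (Suc n)"
    have u: "?u \<in> Units A" using range_left_product(2)[OF gs] by auto
    have "ract (\<phi> (basis_elem gs)) (inv\<^bsub>A\<^esub> ?u) = ract (\<psi> (basis_elem gs)) (inv\<^bsub>A\<^esub> ?u)"
      using eq[OF range_left_product(1)[OF gs]] group_homogenize_left_product[OF _ gs] \<phi> \<psi>
      by (simp add: pure_tensor_basis_elem)
    thus ?thesis using ract_inv(1)[OF u] by metis
  qed
  show ?thesis
  proof (rule extensionalityI[of _ "tensor_power G n"])
    show "\<phi> t = \<psi> t" if "t \<in> tensor_power G n" for t
      using linear_map_expand[of n \<phi> t] linear_map_expand[of n \<psi> t] \<phi> \<psi> that * by (simp add: cochains_def)
  qed (use \<phi> \<psi> in \<open>auto simp: cochains_def\<close>)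
qed

lemma equivariant_group_homogenize:
  assumes \<phi>: "\<phi> \<in> cochains G scale n"
  shows "equivariant n (group_homogenize n \<phi>)"
  unfolding equivariant_def
proof (intro conjI allI impI ballI)
  fix x y :: "nat \<Rightarrow> 'g"
  assume "range x \<subseteq> carrier G" and y: "range y \<subseteq> carrier G" and eq: "\<forall>i\<in>{1..Suc n}. x i = y i"
  have "\<exists>c. c \<noteq> 0 \<and> (basis_elem \<circ> x) i = c \<odot>\<^bsub>A\<^esub> (basis_elem \<circ> y) i" if "i \<in> {1..Suc n}" for i
    using that eq by (intro exI[of _ 1]) (simp add: smult_one_A)
  thus "group_homogenize n \<phi> x = group_homogenize n \<phi> y"
    unfolding group_homogenize_def by (intro homogenize_proportional[OF \<phi>] range_basis y)
next
  fix g and x :: "nat \<Rightarrow> 'g"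
  assume g: "g \<in> carrier G" and x: "range x \<subseteq> carrier G"
  hence xi: "x i \<in> carrier G" for i by auto
  have b: "(basis_elem g \<in> Units A)" using g by (rule inv_basis_elem)
  have "homogenize n \<phi> (\<lambda>i. basis_elem g \<otimes>\<^bsub>A\<^esub> (basis_elem \<circ> x) i) = homogenize n \<phi> (basis_elem \<circ> (\<lambda>i. g \<otimes> x i))"
  proof (rule homogenize_proportional[OF \<phi>])
    show "range (basis_elem \<circ> (\<lambda>i. g \<otimes> x i)) \<subseteq> Units A"
      using g xi by (intro range_basis) auto
    show "\<exists>c. c \<noteq> 0 \<and> basis_elem g \<otimes>\<^bsub>A\<^esub> (basis_elem \<circ> x) i = c \<odot>\<^bsub>A\<^esub> (basis_elem \<circ> (\<lambda>i. g \<otimes> x i)) i" for i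
      using g xi cocycle_nonzero[OF g xi] by (intro exI[of _ "\<alpha> g (x i)"]) (simp add: mult_basis_elem)
  qed
  thus "group_homogenize n \<phi> (\<lambda>i. g \<otimes> x i) =
      lact (basis_elem g) (ract (group_homogenize n \<phi> x) (inv\<^bsub>A\<^esub> (basis_elem g)))"
    using homogenize_translate[OF range_basis[OF x] b] by (simp add: group_homogenize_def)
qed

text \<open>
  With \<open>g\<^sub>i = x\<^sub>i\<^sup>-\<^sup>1x\<^sub>i\<^sub>+\<^sub>1\<close>, the sequence \<open>x\<close> is the left translate by \<open>x\<^sub>1\<close> of the left products of the \<open>g\<^sub>i\<close>,
  so an equivariant function is known once its values at left products are.
\<close>

lemma equivariant_eqI:
  assumes K: "equivariant n K" and L: "equivariant n L"
    and eq: "\<And>gs. gs \<in> tuples G n \<Longrightarrow> K (left_product G gs) = L (left_product G gs)"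
    and x: "range x \<subseteq> carrier G"
  shows "K x = L x"
proof -
  define gs where "gs = map (\<lambda>i. inv (x i) \<otimes> x (Suc i)) [1..<Suc n]"
  have xi [simp]: "x i \<in> carrier G" for i using x by auto
  have gs: "gs \<in> tuples G n" by (auto simp: gs_def tuples_def simp del: upt_Suc)
  have "left_product G gs (Suc j) = inv (x 1) \<otimes> x (Suc j)" if "j \<le> n" for j
    using that
  proof (induction j)
    case (Suc j)
    have "gs ! j = inv (x (Suc j)) \<otimes> x (Suc (Suc j))"
      using Suc.prems by (simp add: gs_def del: upt_Suc)
    moreover have "inv (x 1) \<otimes> x (Suc j) \<otimes> (inv (x (Suc j)) \<otimes> x (Suc (Suc j))) =
        inv (x 1) \<otimes> (x (Suc j) \<otimes> inv (x (Suc j)) \<otimes> x (Suc (Suc j)))"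
      by (simp only: m_assoc inv_closed xi m_closed)
    ultimately show ?case
      using Suc gs left_product_Suc[of "Suc j" gs G] by (simp add: tuples_def)
  qed simp
  hence xgs: "\<forall>i\<in>{1..Suc n}. x i = x 1 \<otimes> left_product G gs i"
    by (auto simp: m_assoc[symmetric] Suc_le_eq gr0_conv_Suc)
  have r: "range (left_product G gs) \<subseteq> carrier G" by (rule range_left_product(1)[OF gs])
  hence r': "range (\<lambda>i. x 1 \<otimes> left_product G gs i) \<subseteq> carrier G" by auto
  have "K' x = lact (basis_elem (x 1)) (ract (K' (left_product G gs)) (inv\<^bsub>A\<^esub> (basis_elem (x 1))))"
    if K': "equivariant n K'" for K'
  proof -
    have "K' x = K' (\<lambda>i. x 1 \<otimes> left_product G gs i)"
      using K' x r' xgs unfolding equivariant_def by blast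
    also have "\<dots> = lact (basis_elem (x 1)) (ract (K' (left_product G gs)) (inv\<^bsub>A\<^esub> (basis_elem (x 1))))"
      using K' r xi[of 1] unfolding equivariant_def by blast
    finally show ?thesis .
  qed
  from this[OF K] this[OF L] eq[OF gs] show ?thesis by simp
qed

lemma group_homogenize_dehomogenize:
  assumes K: "equivariant n K" and x: "range x \<subseteq> carrier G"
  shows "group_homogenize n (dehomogenize n K) x = K x"
proof (rule equivariant_eqI[OF _ K _ x])
  have c: "dehomogenize n K \<in> cochains G scale n"
    unfolding dehomogenize_def by (rule linear_extension_closed)
  show "equivariant n (group_homogenize n (dehomogenize n K))"
    by (rule equivariant_group_homogenize[OF c])
  fix gs assume gs: "gs \<in> tuples G n"
  have "left_product A (map basis_elem gs) (Suc n) \<in> Units A" using range_left_product(2)[OF gs] by auto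
  thus "group_homogenize n (dehomogenize n K) (left_product G gs) = K (left_product G gs)"
    unfolding group_homogenize_left_product[OF c gs]
    by (simp add: dehomogenize_def linear_extension_basis_elem[OF gs] ract_inv)
qed

section \<open>The action of the symmetric group\<close>

text \<open>
  Precomposition with \<open>p\<close> on the coordinates is a left action: if \<open>p\<close> is applied to the result for \<open>q\<close>, the
  argument \<open>x\<close> becomes \<open>(x \<circ> p) \<circ> q = x \<circ> (p \<circ> q)\<close>.
\<close>

definition permute_cochain :: "nat \<Rightarrow> (nat \<Rightarrow> nat) \<Rightarrow> (('g list \<Rightarrow> 'k) \<Rightarrow> 'm) \<Rightarrow> ('g list \<Rightarrow> 'k) \<Rightarrow> 'm" where
  "permute_cochain n p \<phi> =
     dehomogenize n (\<lambda>x. scale (of_int (sign p)) (group_homogenize n \<phi> (x \<circ> p)))"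

lemma permute_cochain_closed: "permute_cochain n p \<phi> \<in> cochains G scale n"
  unfolding permute_cochain_def dehomogenize_def by (rule linear_extension_closed)

lemma equivariant_permute:
  assumes K: "equivariant n K" and p: "p permutes {1..Suc n}"
  shows "equivariant n (\<lambda>x. scale c (K (x \<circ> p)))"
  unfolding equivariant_def
proof (intro conjI allI impI ballI)
  fix x y :: "nat \<Rightarrow> 'g"
  assume "range x \<subseteq> carrier G" "range y \<subseteq> carrier G" "\<forall>i\<in>{1..Suc n}. x i = y i"
  hence "range (x \<circ> p) \<subseteq> carrier G" "range (y \<circ> p) \<subseteq> carrier G" "\<forall>i\<in>{1..Suc n}. (x \<circ> p) i = (y \<circ> p) i"
    using permutes_in_image[OF p] by auto
  hence "K (x \<circ> p) = K (y \<circ> p)" using K unfolding equivariant_def by blast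
  thus "scale c (K (x \<circ> p)) = scale c (K (y \<circ> p))" by simp
next
  fix g and x :: "nat \<Rightarrow> 'g"
  assume g: "g \<in> carrier G" and x: "range x \<subseteq> carrier G"
  hence "range (x \<circ> p) \<subseteq> carrier G" by auto
  hence "K (\<lambda>i. g \<otimes> (x \<circ> p) i) = lact (basis_elem g) (ract (K (x \<circ> p)) (inv\<^bsub>A\<^esub> (basis_elem g)))"
    using K g unfolding equivariant_def by blast
  thus "scale c (K ((\<lambda>i. g \<otimes> x i) \<circ> p)) =
      lact (basis_elem g) (ract (scale c (K (x \<circ> p))) (inv\<^bsub>A\<^esub> (basis_elem g)))"
    using inv_basis_elem(1)[OF g] A.Units_closed by (simp add: o_def lact_scale_right ract_scale_left)
qed

lemma group_homogenize_permute_cochain: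
  assumes "\<phi> \<in> cochains G scale n" "p permutes {1..Suc n}" "range x \<subseteq> carrier G"
  shows "group_homogenize n (permute_cochain n p \<phi>) x = scale (of_int (sign p)) (group_homogenize n \<phi> (x \<circ> p))"
  unfolding permute_cochain_def
  by (intro group_homogenize_dehomogenize equivariant_permute equivariant_group_homogenize assms)

text \<open>
  The formula for \<open>\<sigma>\<^sub>i\<close> is prescribed on tuples of basis elements. These are the ratios of their left products
  in the algebra, to which \<open>homogenize_sigma_formula\<close> applies; the left products in the algebra
  are then replaced by those in the group, which are proportional to them.
\<close>

lemma permute_cochain_transpose:
  assumes \<phi>: "\<phi> \<in> cochains G scale n" and i: "i \<in> {1..n}"
  shows "permute_cochain n (transpose i (Suc i)) \<phi> = sigma G \<alpha> scale lact ract n i \<phi>"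
proof -
  have "ract (scale (of_int (sign (transpose i (Suc i)))) (group_homogenize n \<phi> (left_product G gs \<circ> transpose i (Suc i))))
      (left_product A (map basis_elem gs) (Suc n)) = sigma_formula A lact ract n i \<phi> (map basis_elem gs)"
    if gs: "gs \<in> tuples G n" for gs
  proof -
    let ?u = "left_product A (map basis_elem gs)"
    have u: "range ?u \<subseteq> Units A" by (rule range_left_product(2)[OF gs])
    hence uU: "?u (Suc n) \<in> Units A" by auto
    have r: "ratios ?u n = map basis_elem gs"
      using gs by (intro ratios_left_product) (auto simp: tuples_def inv_basis_elem(1))
    have "transpose i (Suc i) permutes {1..Suc n}" using i by (intro permutes_swap_id) auto
    from homogenize_sigma_formula[OF u i, of \<phi>] homogenize_left_product_permute[OF \<phi> gs this]
    have "ract (sigma_formula A lact ract n i \<phi> (map basis_elem gs)) (inv\<^bsub>A\<^esub> (?u (Suc n))) =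
        - group_homogenize n \<phi> (left_product G gs \<circ> transpose i (Suc i))"
      by (simp add: r lact_one)
    from arg_cong[OF this, of "\<lambda>m. ract m (?u (Suc n))"] show ?thesis
      using uU by (simp add: ract_inv sign_swap_id)
  qed
  thus ?thesis
    unfolding permute_cochain_def dehomogenize_def sigma_def linear_extension_def
    by (intro restrict_ext sum.cong refl) simp
qed

lemma permute_cochain_comp:
  assumes \<phi>: "\<phi> \<in> cochains G scale n" and p: "p permutes {1..Suc n}" and q: "q permutes {1..Suc n}"
  shows "permute_cochain n (p \<circ> q) \<phi> = permute_cochain n p (permute_cochain n q \<phi>)"
proof (rule group_homogenize_inj[OF permute_cochain_closed permute_cochain_closed])
  fix x :: "nat \<Rightarrow> 'g" assume x: "range x \<subseteq> carrier G"
  hence xp: "range (x \<circ> p) \<subseteq> carrier G" by auto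
  have "sign (p \<circ> q) = sign p * sign q"
    using permutes_imp_permutation[OF finite_atLeastAtMost p] permutes_imp_permutation[OF finite_atLeastAtMost q]
    by (rule sign_compose)
  thus "group_homogenize n (permute_cochain n (p \<circ> q) \<phi>) x =
      group_homogenize n (permute_cochain n p (permute_cochain n q \<phi>)) x"
    by (simp only: group_homogenize_permute_cochain[OF \<phi> permutes_compose[OF q p] x]
        group_homogenize_permute_cochain[OF permute_cochain_closed p x]
        group_homogenize_permute_cochain[OF \<phi> q xp] scale_scale of_int_mult o_assoc)
qed

lemma permute_cochain_id:
  assumes \<phi>: "\<phi> \<in> cochains G scale n"
  shows "permute_cochain n id \<phi> = \<phi>"
  by (rule group_homogenize_inj[OF permute_cochain_closed \<phi>])
    (simp add: group_homogenize_permute_cochain \<phi> permutes_id)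


lemma cochain_operations:
  assumes \<phi>: "\<phi> \<in> cochains G scale n"
  shows add_cochains: "\<psi> \<in> cochains G scale n \<Longrightarrow> (\<lambda>t\<in>tensor_power G n. \<phi> t + \<psi> t) \<in> cochains G scale n"
    and scale_cochains: "(\<lambda>t\<in>tensor_power G n. scale c (\<phi> t)) \<in> cochains G scale n"
proof -
  have "(\<lambda>x. s x + t x) \<in> tensor_power G n" "(\<lambda>x. c * t x) \<in> tensor_power G n"
    if "s \<in> tensor_power G n" "t \<in> tensor_power G n" for s t :: "'g list \<Rightarrow> 'k" and c
    using that by (auto simp: tensor_power_def)
  thus "\<psi> \<in> cochains G scale n \<Longrightarrow> (\<lambda>t\<in>tensor_power G n. \<phi> t + \<psi> t) \<in> cochains G scale n"
    "(\<lambda>t\<in>tensor_power G n. scale c (\<phi> t)) \<in> cochains G scale n"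
    using \<phi> by (auto simp: cochains_def linear_map_on_def scale_right_distrib mult.commute)
qed

lemma group_homogenize_operations:
  assumes "range x \<subseteq> carrier G"
  shows group_homogenize_add: "group_homogenize n (\<lambda>t\<in>tensor_power G n. \<phi> t + \<psi> t) x =
      group_homogenize n \<phi> x + group_homogenize n \<psi> x"
    and group_homogenize_scale: "group_homogenize n (\<lambda>t\<in>tensor_power G n. scale c (\<phi> t)) x =
      scale c (group_homogenize n \<phi> x)"
proof -
  have u: "range (basis_elem \<circ> x) \<subseteq> Units A" by (rule range_basis[OF assms])
  hence "pure_tensor (ratios (basis_elem \<circ> x) n) \<in> tensor_power G n"
    by (intro pure_tensor_closed set_ratios) auto
  moreover have "basis_elem (x i) \<in> carrier A" "inv\<^bsub>A\<^esub> (basis_elem (x i)) \<in> carrier A" for i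
    using u by (auto simp: image_subset_iff)
  ultimately show "group_homogenize n (\<lambda>t\<in>tensor_power G n. \<phi> t + \<psi> t) x =
      group_homogenize n \<phi> x + group_homogenize n \<psi> x"
    and "group_homogenize n (\<lambda>t\<in>tensor_power G n. scale c (\<phi> t)) x = scale c (group_homogenize n \<phi> x)"
    by (simp_all add: group_homogenize_def homogenize_def lact_add_right ract_add_left
        lact_scale_right ract_scale_left)
qed

lemma permute_cochain_linear:
  assumes \<phi>: "\<phi> \<in> cochains G scale n" and p: "p permutes {1..Suc n}"
  shows "\<psi> \<in> cochains G scale n \<Longrightarrow> permute_cochain n p (\<lambda>t\<in>tensor_power G n. \<phi> t + \<psi> t) =
      (\<lambda>t\<in>tensor_power G n. permute_cochain n p \<phi> t + permute_cochain n p \<psi> t)"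
    and "permute_cochain n p (\<lambda>t\<in>tensor_power G n. scale c (\<phi> t)) =
      (\<lambda>t\<in>tensor_power G n. scale c (permute_cochain n p \<phi> t))"
proof -
  note pc = permute_cochain_closed
  have xp: "range (x \<circ> p) \<subseteq> carrier G" if "range x \<subseteq> carrier G" for x using that by auto
  show "permute_cochain n p (\<lambda>t\<in>tensor_power G n. scale c (\<phi> t)) =
      (\<lambda>t\<in>tensor_power G n. scale c (permute_cochain n p \<phi> t))"
    by (rule group_homogenize_inj[OF pc scale_cochains[OF pc]])
      (simp only: group_homogenize_permute_cochain[OF scale_cochains[OF \<phi>] p]
        group_homogenize_permute_cochain[OF \<phi> p] group_homogenize_scale[OF xp] group_homogenize_scale
        scale_scale mult.commute)
  assume \<psi>: "\<psi> \<in> cochains G scale n"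
  show "permute_cochain n p (\<lambda>t\<in>tensor_power G n. \<phi> t + \<psi> t) =
      (\<lambda>t\<in>tensor_power G n. permute_cochain n p \<phi> t + permute_cochain n p \<psi> t)"
    by (rule group_homogenize_inj[OF pc add_cochains[OF pc pc]])
      (simp only: group_homogenize_permute_cochain[OF add_cochains[OF \<phi> \<psi>] p]
        group_homogenize_permute_cochain[OF \<phi> p] group_homogenize_permute_cochain[OF \<psi> p]
        group_homogenize_add[OF xp] group_homogenize_add scale_right_distrib)
qed

lemma is_sigma_action_permute_cochain:
  "is_sigma_action G \<alpha> scale lact ract n
     (\<lambda>p\<in>carrier (sym_group (n + 1)). \<lambda>\<phi>\<in>cochains G scale n. permute_cochain n p \<phi>)"
  (is "is_sigma_action _ _ _ _ _ _ ?\<rho>")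
proof -
  let ?S = "sym_group (n + 1)" and ?E = "cochains G scale n"
  have S: "p \<in> carrier ?S \<longleftrightarrow> p permutes {1..Suc n}" for p by (simp add: sym_group_carrier)
  have Bij: "?\<rho> p \<in> Bij ?E" if p: "p \<in> carrier ?S" for p
  proof -
    have p': "p permutes {1..Suc n}" "inv' p permutes {1..Suc n}" using p S permutes_inv by auto
    have "bij_betw (?\<rho> p) ?E ?E"
      using p p' permute_cochain_comp[symmetric, of _ n p "inv' p"] permute_cochain_comp[symmetric, of _ n "inv' p" p]
      by (intro bij_betw_byWitness[where f' = "permute_cochain n (inv' p)"])
        (auto simp: permute_cochain_closed permutes_inv_o permute_cochain_id)
    thus ?thesis using p by (simp add: Bij_def)
  qed
  have "group_action ?S ?E ?\<rho>"
    unfolding group_action_def group_hom_def group_hom_axioms_def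
  proof (intro conjI homI)
    show "?\<rho> p \<in> carrier (BijGroup ?E)" if "p \<in> carrier ?S" for p
      using Bij[OF that] by (simp add: BijGroup_def)
    fix p q assume pq: "p \<in> carrier ?S" "q \<in> carrier ?S"
    hence "p \<circ> q \<in> carrier ?S" using S permutes_compose by blast
    moreover have "permute_cochain n (p \<circ> q) \<phi> = permute_cochain n p (permute_cochain n q \<phi>)" if "\<phi> \<in> ?E" for \<phi>
      using permute_cochain_comp that pq S by blast
    ultimately show "?\<rho> (p \<otimes>\<^bsub>?S\<^esub> q) = ?\<rho> p \<otimes>\<^bsub>BijGroup ?E\<^esub> ?\<rho> q"
      using pq Bij[OF pq(1)] Bij[OF pq(2)]
      by (auto simp: sym_group_mult BijGroup_def compose_def permute_cochain_closed fun_eq_iff restrict_def)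
  qed (rule sym_group_is_group group_BijGroup)+
  moreover have "transpose i (i + 1) \<in> carrier ?S" if "i \<in> {1..n}" for i
    unfolding S using that by (intro permutes_swap_id) auto
  ultimately show ?thesis
    unfolding is_sigma_action_def
  proof (intro conjI ballI allI)
    fix p and \<phi> :: "('g list \<Rightarrow> 'k) \<Rightarrow> 'm" assume p: "p \<in> carrier ?S" and \<phi>: "\<phi> \<in> ?E"
    have p': "p permutes {1..Suc n}" using p S by simp
    show "?\<rho> p (\<lambda>t\<in>tensor_power G n. \<phi> t + \<psi> t) = (\<lambda>t\<in>tensor_power G n. ?\<rho> p \<phi> t + ?\<rho> p \<psi> t)"
      if "\<psi> \<in> ?E" for \<psi>
      using permute_cochain_linear(1)[OF \<phi> p' that] p \<phi> that add_cochains[OF \<phi> that] by (simp only: restrict_apply')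
    show "?\<rho> p (\<lambda>t\<in>tensor_power G n. scale c (\<phi> t)) = (\<lambda>t\<in>tensor_power G n. scale c (?\<rho> p \<phi> t))" for c
      using permute_cochain_linear(2)[OF \<phi> p'] p \<phi> scale_cochains[OF \<phi>] by (simp only: restrict_apply')
  qed (simp_all add: permute_cochain_transpose del: restrict_apply add: restrict_apply')
qed

text \<open>
  The \<open>\<sigma>\<^sub>i\<close> prescribe the action of adjacent transpositions, and these generate the symmetric group.
\<close>

lemma is_sigma_action_unique:
  assumes \<rho>: "is_sigma_action G \<alpha> scale lact ract n \<rho>"
    and p: "p \<in> carrier (sym_group (n + 1))" and \<phi>: "\<phi> \<in> cochains G scale n"
  shows "\<rho> p \<phi> = permute_cochain n p \<phi>"
proof -
  interpret group_action "sym_group (n + 1)" "cochains G scale n" \<rho>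
    using \<rho> by (simp add: is_sigma_action_def)
  have "p permutes {1..Suc n}" using p by (simp add: sym_group_carrier)
  thus ?thesis
  proof (induction rule: permutes_adjacent_induct)
    case id
    have "\<rho> id \<phi> = permute_cochain n id \<phi>"
      using \<phi> fun_cong[OF id_eq_one, of \<phi>] by (simp add: sym_group_one permute_cochain_id)
    thus ?case by (simp add: id_def)
  next
    case (adjacent i q)
    let ?t = "transpose i (Suc i)"
    have t: "?t permutes {1..Suc n}" using adjacent.hyps by (intro permutes_swap_id) auto
    have "\<rho> (?t \<circ> q) \<phi> = \<rho> ?t (\<rho> q \<phi>)"
      using composition_rule[OF \<phi>, of ?t q] t adjacent.hyps by (simp add: sym_group_mult sym_group_carrier)
    also have "\<dots> = sigma G \<alpha> scale lact ract n i (permute_cochain n q \<phi>)"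
      using \<rho> adjacent permute_cochain_closed by (simp add: is_sigma_action_def)
    also have "\<dots> = permute_cochain n (?t \<circ> q) \<phi>"
      using adjacent.hyps by (simp only: permute_cochain_transpose[OF permute_cochain_closed] permute_cochain_comp[OF \<phi> t])
    finally show ?case by (simp add: o_def)
  qed
qed

theorem ex1_sigma_action:
  "\<exists>!\<rho>. \<rho> \<in> extensional (carrier (sym_group (n + 1))) \<and> is_sigma_action G \<alpha> scale lact ract n \<rho>"
proof (rule ex_ex1I)
  show "\<exists>\<rho>. \<rho> \<in> extensional (carrier (sym_group (n + 1))) \<and> is_sigma_action G \<alpha> scale lact ract n \<rho>"
    using is_sigma_action_permute_cochain by blast
  fix \<rho> \<rho>'
  assume "\<rho> \<in> extensional (carrier (sym_group (n + 1))) \<and> is_sigma_action G \<alpha> scale lact ract n \<rho>"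
    and "\<rho>' \<in> extensional (carrier (sym_group (n + 1))) \<and> is_sigma_action G \<alpha> scale lact ract n \<rho>'"
  hence ext: "\<rho> \<in> extensional (carrier (sym_group (n + 1)))" "\<rho>' \<in> extensional (carrier (sym_group (n + 1)))"
    and act: "is_sigma_action G \<alpha> scale lact ract n \<rho>" "is_sigma_action G \<alpha> scale lact ract n \<rho>'"
    by auto
  show "\<rho> = \<rho>'"
  proof (rule extensionalityI[OF ext])
    fix p assume p: "p \<in> carrier (sym_group (n + 1))"
    have "\<tau> p \<in> extensional (cochains G scale n)" if "is_sigma_action G \<alpha> scale lact ract n \<tau>" for \<tau>
      using that by (intro Bij_imp_extensional group_action.bij_prop0[OF _ p]) (simp add: is_sigma_action_def)
    thus "\<rho> p = \<rho>' p"
      using act by (intro extensionalityI[of _ "cochains G scale n"])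
        (simp_all add: is_sigma_action_unique p del: One_nat_def add_Suc_right)
  qed
qed

text \<open>
  Invariance needs to be tested on the generators only, and the sign of a transposition is \<open>-1\<close>.
\<close>

theorem fixed_points_iff_alternating:
  assumes \<rho>: "is_sigma_action G \<alpha> scale lact ract n \<rho>" and \<phi>: "\<phi> \<in> cochains G scale n"
  shows "\<phi> \<in> fixed_points (sym_group (n + 1)) (cochains G scale n) \<rho> \<longleftrightarrow>
    (\<forall>i\<in>{1..n}. \<forall>x. range x \<subseteq> carrier G \<longrightarrow>
       group_homogenize n \<phi> (x \<circ> transpose i (Suc i)) = - group_homogenize n \<phi> x)"
    (is "?fixed \<longleftrightarrow> ?alternating")
proof -
  have t: "transpose i (Suc i) permutes {1..Suc n}" if "i \<in> {1..n}" for i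
    using that by (intro permutes_swap_id) auto
  have H: "group_homogenize n (permute_cochain n (transpose i (Suc i)) \<phi>) x =
      - group_homogenize n \<phi> (x \<circ> transpose i (Suc i))" if "i \<in> {1..n}" "range x \<subseteq> carrier G" for i x
    using group_homogenize_permute_cochain[OF \<phi> t[OF that(1)] that(2)] by (simp add: sign_swap_id)
  have fixed: "?fixed \<longleftrightarrow> (\<forall>p. p permutes {1..Suc n} \<longrightarrow> permute_cochain n p \<phi> = \<phi>)"
    using \<phi> is_sigma_action_unique[OF \<rho> _ \<phi>] by (auto simp: fixed_points_def sym_group_carrier)
  show ?thesis
  proof
    assume ?fixed
    hence "permute_cochain n (transpose i (Suc i)) \<phi> = \<phi>" if "i \<in> {1..n}" for i
      using fixed t[OF that] by blast
    thus ?alternating using H by (metis minus_minus)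
  next
    assume alt: ?alternating
    have *: "permute_cochain n (transpose i (Suc i)) \<phi> = \<phi>" if "i \<in> {1..n}" for i
      using alt H that by (intro group_homogenize_inj[OF permute_cochain_closed \<phi>]) auto
    have "permute_cochain n p \<phi> = \<phi>" if "p permutes {1..Suc n}" for p
      using that
    proof (induction rule: permutes_adjacent_induct)
      case (adjacent i q)
      thus ?case using permute_cochain_comp[OF \<phi> t[OF adjacent.hyps(1)] adjacent.hyps(2)] * by (simp add: o_def)
    qed (rule permute_cochain_id[OF \<phi>])
    thus ?fixed using fixed by blast
  qed
qed

section \<open>Invariance of differentials\<close>

text \<open>
  In homogeneous form the differential of \<open>m\<close> is \<open>x\<^sub>2 \<cdot> m \<cdot> x\<^sub>2\<^sup>-\<^sup>1 - x\<^sub>1 \<cdot> m \<cdot> x\<^sub>1\<^sup>-\<^sup>1\<close>, which is alternating.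
\<close>

theorem hochschild_diff0_fixed:
  assumes \<rho>: "is_sigma_action G \<alpha> scale lact ract 1 \<rho>"
  shows "hochschild_diff0 G \<alpha> scale lact ract m \<in> fixed_points (sym_group 2) (cochains G scale 1) \<rho>"
proof -
  let ?d = "hochschild_diff0 G \<alpha> scale lact ract m"
  define K where "K u = lact u (ract m (inv\<^bsub>A\<^esub> u))" for u
  have *: "group_homogenize 1 ?d x = K (basis_elem (x 2)) - K (basis_elem (x 1))" if "range x \<subseteq> carrier G" for x
  proof -
    let ?u = "\<lambda>i. basis_elem (x i)"
    have u: "?u i \<in> Units A" for i
      using that by (intro inv_basis_elem(1)) auto
    hence uA: "?u i \<in> carrier A" "inv\<^bsub>A\<^esub> (?u i) \<in> carrier A" for i by auto
    have diff: "lact (?u i) (a - b) = lact (?u i) a - lact (?u i) b"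
      "ract (a - b) (inv\<^bsub>A\<^esub> (?u i)) = ract a (inv\<^bsub>A\<^esub> (?u i)) - ract b (inv\<^bsub>A\<^esub> (?u i))" for a b i
      using lact_add_right[OF uA(1), of i a "- b"] ract_add_left[OF uA(2), of a "- b" i]
      by (simp_all add: act_minus uA)
    have "ratios (basis_elem \<circ> x) 1 = [inv\<^bsub>A\<^esub> (?u 1) \<otimes>\<^bsub>A\<^esub> ?u 2]"
      by (intro nth_equalityI) (auto simp: numeral_2_eq_2)
    hence "group_homogenize 1 ?d x =
        lact (?u 1) (ract (lact (inv\<^bsub>A\<^esub> (?u 1) \<otimes>\<^bsub>A\<^esub> ?u 2) m - ract m (inv\<^bsub>A\<^esub> (?u 1) \<otimes>\<^bsub>A\<^esub> ?u 2)) (inv\<^bsub>A\<^esub> (?u 2)))"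
      using u by (simp add: group_homogenize_def homogenize_def hochschild_diff0(2) uA numeral_2_eq_2)
    also have "\<dots> = K (?u 2) - K (?u 1)"
      using u by (simp add: diff K_def ratio_simps lact_ract uA)
    finally show ?thesis .
  qed
  have "?d \<in> fixed_points (sym_group (1 + 1)) (cochains G scale 1) \<rho>"
    unfolding fixed_points_iff_alternating[OF \<rho> hochschild_diff0(1)]
  proof (intro ballI allI impI)
    fix i and x :: "nat \<Rightarrow> 'g" assume i: "i \<in> {1..1::nat}" and x: "range x \<subseteq> carrier G"
    hence "range (x \<circ> transpose i (Suc i)) \<subseteq> carrier G" by auto
    thus "group_homogenize 1 ?d (x \<circ> transpose i (Suc i)) = - group_homogenize 1 ?d x"
      using i by (simp only: * x) (simp add: numeral_2_eq_2)
  qed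
  thus ?thesis by (simp only: one_add_one)
qed

theorem hochschild_diff_fixed:
  assumes \<rho>: "is_sigma_action G \<alpha> scale lact ract n \<rho>" and \<rho>': "is_sigma_action G \<alpha> scale lact ract (n + 1) \<rho>'"
    and fixed: "\<phi> \<in> fixed_points (sym_group (n + 1)) (cochains G scale n) \<rho>"
  shows "hochschild_diff G \<alpha> scale lact ract n \<phi> \<in> fixed_points (sym_group (n + 2)) (cochains G scale (n + 1)) \<rho>'"
proof -
  let ?d = "hochschild_diff G \<alpha> scale lact ract n \<phi>"
  have \<phi>: "\<phi> \<in> cochains G scale n" using fixed by (simp add: fixed_points_def)
  have D: "group_homogenize (n + 1) ?d x = (\<Sum>j=1..n+2. scale ((-1) ^ (j + 1)) (group_homogenize n \<phi> (x \<circ> skip j)))"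
    if "range x \<subseteq> carrier G" for x
    using homogenize_hochschild_diff[OF range_basis[OF that] \<phi>] by (simp add: group_homogenize_def comp_assoc)
  have "?d \<in> fixed_points (sym_group (n + 1 + 1)) (cochains G scale (n + 1)) \<rho>'"
    unfolding fixed_points_iff_alternating[OF \<rho>' hochschild_diff(1)[OF \<phi>]]
    using alternating_coboundary[where X = "carrier G" and D = "group_homogenize (n + 1) ?d" and n = n
        and s = "\<lambda>j. scale ((-1) ^ (j + 1))" and H = "group_homogenize n \<phi>", OF D] fixed
    unfolding fixed_points_iff_alternating[OF \<rho> \<phi>] by simp
  thus ?thesis by simp
qed

end

theorem proposition4p2:
  fixes G :: "('g, 'z) monoid_scheme"
    and \<alpha> :: "'g \<Rightarrow> 'g \<Rightarrow> 'k::field"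
    and scale :: "'k \<Rightarrow> 'm::ab_group_add \<Rightarrow> 'm"
    and lact :: "('g \<Rightarrow> 'k) \<Rightarrow> 'm \<Rightarrow> 'm"
    and ract :: "'m \<Rightarrow> ('g \<Rightarrow> 'k) \<Rightarrow> 'm"
  assumes "group G" and "finite (carrier G)"
    and "normalized_2cocycle G \<alpha>"
    and "bimodule (twisted_group_algebra G \<alpha>) scale lact ract"
  shows "(\<forall>n\<ge>1. \<exists>!\<rho>. \<rho> \<in> extensional (carrier (sym_group (n + 1))) \<and>
              is_sigma_action G \<alpha> scale lact ract n \<rho>)
    \<and> (\<forall>\<rho>. is_sigma_action G \<alpha> scale lact ract 1 \<rho> \<longrightarrow>
         (\<forall>m \<in> fixed_points (sym_group 1) UNIV (\<lambda>p m. m).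
            hochschild_diff0 G \<alpha> scale lact ract m \<in> fixed_points (sym_group 2) (cochains G scale 1) \<rho>))
    \<and> (\<forall>n\<ge>1. \<forall>\<rho> \<rho>'. is_sigma_action G \<alpha> scale lact ract n \<rho> \<and>
             is_sigma_action G \<alpha> scale lact ract (n + 1) \<rho>' \<longrightarrow>
         (\<forall>\<phi> \<in> fixed_points (sym_group (n + 1)) (cochains G scale n) \<rho>.
            hochschild_diff G \<alpha> scale lact ract n \<phi>
              \<in> fixed_points (sym_group (n + 2)) (cochains G scale (n + 1)) \<rho>'))"
proof -
  interpret twisted_bimodule G \<alpha> scale lact ract
    by (intro twisted_bimodule.intro twisted_group.intro twisted_group_axioms.intro assms)
  show ?thesis
  proof (intro conjI allI impI ballI)
    fix n \<rho> \<rho>' \<phi>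
    assume "is_sigma_action G \<alpha> scale lact ract n \<rho> \<and> is_sigma_action G \<alpha> scale lact ract (n + 1) \<rho>'"
      and "\<phi> \<in> fixed_points (sym_group (n + 1)) (cochains G scale n) \<rho>"
    thus "hochschild_diff G \<alpha> scale lact ract n \<phi> \<in> fixed_points (sym_group (n + 2)) (cochains G scale (n + 1)) \<rho>'"
      using hochschild_diff_fixed by blast
  qed (rule ex1_sigma_action hochschild_diff0_fixed; assumption?)+
qed

end
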